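(* Let $g\in L^2(\mathbb{R}^{2d},\mathbb{R})$ be a non-zero real valued window function. Then every quaternion function $f\in L^2(\mathbb{R}^{2d},\mathbb{H})$ can be fully reconstructed by $$f(t)=\frac{1}{\|g\|_{2,2d}^2}\iint_{\mathbb{R}^{2d}\times\mathbb{R}^{2d}}e^{i\,t_1\cdot w_1}\,\mathcal{G}_gf(x,w)\,g(t-x)\,e^{j\,t_2\cdot w_2}\,d\mu_{2d}(w)\,d\mu_{2d}(x),$$ where $t=(t_1,t_2)$ and $w=(w_1,w_2)$ belong to $\mathbb{R}^d\times\mathbb{R}^d$.
   Context: $d\ge 1$ is an integer and $\mathbb{H}$ is the algebra of quaternions with units $i,j,k$. On $\mathbb{R}^n$, $d\mu_n(x)=dx/(2\pi)^{n/2}$ and $\|f\|_{2,n}=\big(\int_{\mathbb{R}^n}|f|^2d\mu_n\big)^{1/2}$. For $f\in L^2(\mathbb{R}^{2d},\mathbb{H})$ and non-zero $g\in L^2(\mathbb{R}^{2d},\mathbb{H})$ (a window function), the two sided quaternion windowed Fourier transform of $f$ with respect to $g$, written $\mathcal{G}_g(f)$ or $\mathcal{G}_gf$, is $$\mathcal{G}_g(f)(x,w)=\int_{\mathbb{R}^{2d}}e^{-i\,s\cdot u}f(y)\overline{g(y-x)}e^{-j\,r\cdot v}\,d\mu_{2d}(y),\quad x\in\mathbb{R}^{2d},\ w=(u,v),\ y=(s,r)\in\mathbb{R}^d\times\mathbb{R}^d.$$ *)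

theory Defs
  imports "HOL-Analysis.Analysis"
begin

section \<open>Quaternions\<close>

datatype quat = Quat (qre: real) (qim1: real) (qim2: real) (qim3: real)

lemma quat_eq_iff:
  "a = b \<longleftrightarrow> qre a = qre b \<and> qim1 a = qim1 b \<and> qim2 a = qim2 b \<and> qim3 a = qim3 b"
  by (cases a; cases b) simp

instantiation quat :: ab_group_add
begin

definition zero_quat :: quat
  where "0 = Quat 0 0 0 0"
definition plus_quat :: "quat \<Rightarrow> quat \<Rightarrow> quat"
  where "a + b = Quat (qre a + qre b) (qim1 a + qim1 b) (qim2 a + qim2 b) (qim3 a + qim3 b)"
definition uminus_quat :: "quat \<Rightarrow> quat"
  where "- a = Quat (- qre a) (- qim1 a) (- qim2 a) (- qim3 a)"
definition minus_quat :: "quat \<Rightarrow> quat \<Rightarrow> quat"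
  where "a - b = Quat (qre a - qre b) (qim1 a - qim1 b) (qim2 a - qim2 b) (qim3 a - qim3 b)"

instance
  by standard (simp_all add: zero_quat_def plus_quat_def uminus_quat_def minus_quat_def)

end

lemma quat_add_sel [simp]:
  "qre 0 = 0" "qim1 0 = 0" "qim2 0 = 0" "qim3 0 = 0"
  "qre (a + b) = qre a + qre b" "qim1 (a + b) = qim1 a + qim1 b"
  "qim2 (a + b) = qim2 a + qim2 b" "qim3 (a + b) = qim3 a + qim3 b"
  "qre (- a) = - qre a" "qim1 (- a) = - qim1 a" "qim2 (- a) = - qim2 a" "qim3 (- a) = - qim3 a"
  "qre (a - b) = qre a - qre b" "qim1 (a - b) = qim1 a - qim1 b"
  "qim2 (a - b) = qim2 a - qim2 b" "qim3 (a - b) = qim3 a - qim3 b"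
  by (simp_all add: zero_quat_def plus_quat_def uminus_quat_def minus_quat_def)

instantiation quat :: real_vector
begin

definition scaleR_quat :: "real \<Rightarrow> quat \<Rightarrow> quat"
  where "c *\<^sub>R a = Quat (c * qre a) (c * qim1 a) (c * qim2 a) (c * qim3 a)"

instance
  by standard (simp_all add: scaleR_quat_def quat_eq_iff algebra_simps)

end

lemma quat_scaleR_sel [simp]:
  "qre (c *\<^sub>R a) = c * qre a" "qim1 (c *\<^sub>R a) = c * qim1 a"
  "qim2 (c *\<^sub>R a) = c * qim2 a" "qim3 (c *\<^sub>R a) = c * qim3 a"
  by (simp_all add: scaleR_quat_def)

instantiation quat :: real_inner
begin

definition inner_quat :: "quat \<Rightarrow> quat \<Rightarrow> real"
  where "a \<bullet> b = qre a * qre b + qim1 a * qim1 b + qim2 a * qim2 b + qim3 a * qim3 b"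
definition norm_quat :: "quat \<Rightarrow> real"
  where "norm a = sqrt ((qre a)\<^sup>2 + (qim1 a)\<^sup>2 + (qim2 a)\<^sup>2 + (qim3 a)\<^sup>2)"
definition dist_quat :: "quat \<Rightarrow> quat \<Rightarrow> real"
  where "dist a b = norm (a - b :: quat)"
definition sgn_quat :: "quat \<Rightarrow> quat"
  where "sgn a = (a::quat) /\<^sub>R norm a"
definition uniformity_quat :: "(quat \<times> quat) filter"
  where "uniformity = (INF e\<in>{0<..}. principal {(a, b). dist (a::quat) b < e})"
definition open_quat :: "quat set \<Rightarrow> bool"
  where "open (U :: quat set) \<longleftrightarrow> (\<forall>a\<in>U. eventually (\<lambda>(a', b). a' = a \<longrightarrow> b \<in> U) uniformity)"

instance
proof
  fix a b c :: quat and r :: real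
  show "0 \<le> a \<bullet> a"
    by (simp add: inner_quat_def)
  show "a \<bullet> a = 0 \<longleftrightarrow> a = 0"
  proof
    assume "a \<bullet> a = 0"
    then have "(qre a)\<^sup>2 + (qim1 a)\<^sup>2 + (qim2 a)\<^sup>2 + (qim3 a)\<^sup>2 = 0"
      by (simp add: inner_quat_def power2_eq_square)
    moreover have "0 \<le> (qre a)\<^sup>2" "0 \<le> (qim1 a)\<^sup>2" "0 \<le> (qim2 a)\<^sup>2" "0 \<le> (qim3 a)\<^sup>2"
      by simp_all
    ultimately have "(qre a)\<^sup>2 = 0" "(qim1 a)\<^sup>2 = 0" "(qim2 a)\<^sup>2 = 0" "(qim3 a)\<^sup>2 = 0"
      by linarith+
    then show "a = 0"
      by (simp add: quat_eq_iff)
  qed (simp add: inner_quat_def)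
qed (simp_all add: inner_quat_def norm_quat_def dist_quat_def sgn_quat_def uniformity_quat_def
      open_quat_def algebra_simps power2_eq_square)

end

instantiation quat :: euclidean_space
begin

definition Basis_quat :: "quat set"
  where "Basis = {Quat 1 0 0 0, Quat 0 1 0 0, Quat 0 0 1 0, Quat 0 0 0 1}"

instance
proof
  fix a b :: quat
  show "(Basis :: quat set) \<noteq> {}" "finite (Basis :: quat set)"
    by (simp_all add: Basis_quat_def)
  show "a \<bullet> b = (if a = b then 1 else 0)" if "a \<in> Basis" "b \<in> Basis"
    using that unfolding Basis_quat_def
    by (elim insertE emptyE) (simp_all add: inner_quat_def)
  show "(\<forall>u\<in>Basis. a \<bullet> u = 0) \<longleftrightarrow> a = 0"
    by (simp add: Basis_quat_def inner_quat_def quat_eq_iff [of a 0])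
qed

end

instantiation quat :: real_normed_div_algebra
begin

definition one_quat :: quat
  where "1 = Quat 1 0 0 0"
definition times_quat :: "quat \<Rightarrow> quat \<Rightarrow> quat"
  where "a * b = Quat
    (qre a * qre b - qim1 a * qim1 b - qim2 a * qim2 b - qim3 a * qim3 b)
    (qre a * qim1 b + qim1 a * qre b + qim2 a * qim3 b - qim3 a * qim2 b)
    (qre a * qim2 b - qim1 a * qim3 b + qim2 a * qre b + qim3 a * qim1 b)
    (qre a * qim3 b + qim1 a * qim2 b - qim2 a * qim1 b + qim3 a * qre b)"
definition inverse_quat :: "quat \<Rightarrow> quat"
  where "inverse a = Quat (qre a) (- qim1 a) (- qim2 a) (- qim3 a) /\<^sub>R (norm a)\<^sup>2"
definition divide_quat :: "quat \<Rightarrow> quat \<Rightarrow> quat"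
  where "a div b = a * inverse (b::quat)"

instance
proof
  fix a b c :: quat and r :: real
  have sq: "(norm x)\<^sup>2 = (qre x)\<^sup>2 + (qim1 x)\<^sup>2 + (qim2 x)\<^sup>2 + (qim3 x)\<^sup>2" for x :: quat
    by (simp add: norm_quat_def)
  show "a * b * c = a * (b * c)"
    unfolding times_quat_def quat.sel quat.inject by (intro conjI; algebra)
  show "1 * a = a" "a * 1 = a"
    by (simp_all add: times_quat_def one_quat_def)
  show "(a + b) * c = a * c + b * c" "a * (b + c) = a * b + a * c"
    unfolding times_quat_def quat_add_sel quat.sel quat_eq_iff by (intro conjI; algebra)+
  show "(0::quat) \<noteq> 1"
    by (simp add: one_quat_def quat_eq_iff)
  show "inverse (0::quat) = 0"
    by (simp add: inverse_quat_def)
  show "a div b = a * inverse b"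
    by (simp add: divide_quat_def)
  show "norm (a * b) = norm a * norm b"
  proof (rule power2_eq_imp_eq)
    show "(norm (a * b))\<^sup>2 = (norm a * norm b)\<^sup>2"
      unfolding power_mult_distrib sq
      unfolding times_quat_def quat.sel by algebra
  qed simp_all
  have left: "r *\<^sub>R a * b = r *\<^sub>R (a * b)" and right: "a * r *\<^sub>R b = r *\<^sub>R (a * b)"
    for r :: real and a b :: quat
    unfolding times_quat_def quat_scaleR_sel quat.sel quat_eq_iff by (intro conjI; algebra)+
  show "r *\<^sub>R a * b = r *\<^sub>R (a * b)" "a * r *\<^sub>R b = r *\<^sub>R (a * b)"
    by (fact left right)+
  show "inverse a * a = 1" "a * inverse a = 1" if "a \<noteq> 0"
  proof -
    let ?c = "Quat (qre a) (- qim1 a) (- qim2 a) (- qim3 a)"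
    have "?c * a = (norm a)\<^sup>2 *\<^sub>R 1" "a * ?c = (norm a)\<^sup>2 *\<^sub>R 1"
      unfolding sq times_quat_def one_quat_def quat_scaleR_sel quat.sel quat_eq_iff
      by (intro conjI; algebra)+
    with that show "inverse a * a = 1" "a * inverse a = 1"
      by (simp_all add: inverse_quat_def left right)
  qed
qed

end

definition qi :: quat where "qi = Quat 0 1 0 0"
definition qj :: quat where "qj = Quat 0 0 1 0"
definition qk :: quat where "qk = Quat 0 0 0 1"

lemma quat_units:
  "qi * qi = -1" "qj * qj = -1" "qk * qk = -1"
  "qi * qj = qk" "qj * qk = qi" "qk * qi = qj" "qj * qi = - qk" "qk * qj = - qi" "qi * qk = - qj"
  by (simp_all add: qi_def qj_def qk_def times_quat_def one_quat_def quat_eq_iff)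

definition qcnj :: "quat \<Rightarrow> quat"
  where "qcnj a = Quat (qre a) (- qim1 a) (- qim2 a) (- qim3 a)"


section \<open>Square-integrable functions\<close>

definition mu :: "'a::euclidean_space measure"
  where "mu = density lborel (\<lambda>_. ennreal (1 / (2 * pi) powr (real DIM('a) / 2)))"

definition square_integrable ::
    "('a::euclidean_space \<Rightarrow> 'b::{real_normed_vector,second_countable_topology}) \<Rightarrow> bool"
  where "square_integrable f \<longleftrightarrow> f \<in> borel_measurable mu \<and> integrable mu (\<lambda>x. (norm (f x))\<^sup>2)"

definition norm2 :: "('a::euclidean_space \<Rightarrow> 'b::real_normed_vector) \<Rightarrow> real"
  where "norm2 f = sqrt (LINT x|mu. (norm (f x))\<^sup>2)"

definition window ::
    "('a::euclidean_space \<Rightarrow> 'b::{real_normed_vector,second_countable_topology}) \<Rightarrow> bool"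
  where "window g \<longleftrightarrow> square_integrable g \<and> \<not> (AE x in mu. g x = 0)"

text \<open>
  The equation \<open>h(t) = \<integral> F(t,p) dM(p)\<close> between square-integrable functions of \<open>t\<close>, where \<open>F(t,\<cdot>)\<close>
  need not be Lebesgue integrable: for every exhaustion of the domain of integration by compact
  sets, the truncated integrals converge absolutely for every \<open>t\<close>, are square-integrable in \<open>t\<close>,
  and converge to \<open>h\<close> in \<open>L\<^sup>2\<close>. The integrability clauses are needed because the
  library's integral of a non-integrable function is \<open>0\<close>.
\<close>
definition has_L2_integral ::
    "('p::euclidean_space) measure \<Rightarrow> ('a::euclidean_space \<Rightarrow> 'p \<Rightarrow> quat) \<Rightarrow> ('a \<Rightarrow> quat) \<Rightarrow> bool"
  where "has_L2_integral M F h \<longleftrightarrow>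
    square_integrable h \<and>
    (\<forall>K. (\<forall>n. compact (K n)) \<and> incseq K \<and> (\<Union>n. K n) = UNIV \<longrightarrow>
      (\<forall>n t. set_integrable M (K n) (F t)) \<and>
      (\<forall>n. square_integrable (\<lambda>t. LINT p:K n|M. F t p)) \<and>
      (\<lambda>n. norm2 (\<lambda>t. (LINT p:K n|M. F t p) - h t)) \<longlonglongrightarrow> 0)"


section \<open>The two-sided quaternion windowed Fourier transform\<close>

definition qwft ::
    "((real^'d) \<times> (real^'d) \<Rightarrow> quat) \<Rightarrow> ((real^'d) \<times> (real^'d) \<Rightarrow> quat) \<Rightarrow>
     (real^'d) \<times> (real^'d) \<Rightarrow> (real^'d) \<times> (real^'d) \<Rightarrow> quat"
  where "qwft g f x w = (LINT y|mu.
    exp (- ((fst y \<bullet> fst w) *\<^sub>R qi)) * f y * qcnj (g (y - x)) * exp (- ((snd y \<bullet> snd w) *\<^sub>R qj)))"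

definition qwft_synthesis_integrand ::
    "((real^'d) \<times> (real^'d) \<Rightarrow> real) \<Rightarrow> ((real^'d) \<times> (real^'d) \<Rightarrow> quat) \<Rightarrow>
     (real^'d) \<times> (real^'d) \<Rightarrow> (real^'d) \<times> (real^'d) \<Rightarrow> (real^'d) \<times> (real^'d) \<Rightarrow> quat"
  where "qwft_synthesis_integrand g f t x w =
    exp ((fst t \<bullet> fst w) *\<^sub>R qi) * qwft (\<lambda>y. of_real (g y)) f x w * of_real (g (t - x)) *
    exp ((snd t \<bullet> snd w) *\<^sub>R qj)"

end

theory Submission
  imports Defs "HOL-Probability.Characteristic_Functions"
begin

text \<open>
  For fixed \<open>x\<close> the windowed transform is the two-sided Fourier transform of the slice
  \<open>y \<mapsto> g (y - x) f y\<close>, which is integrable for every \<open>x\<close> and square-integrable for almost every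
  \<open>x\<close>. The two-sided kernel \<open>twist y w\<close> is an isometric action in \<open>y\<close>
  whose adjoint is \<open>twist (- y) w\<close>, and its Gaussian average over \<open>w\<close> is a real Gaussian in \<open>y\<close>;
  so Plancherel follows as in the commutative case, by Gaussian
  summation and continuity of translations in \<open>L\<^sup>2\<close>. Integrating over the slices, \<open>f \<mapsto> stft g f\<close> is
  \<open>norm2 g\<close> times an isometry and the truncated synthesis integral is its adjoint applied to
  the cut-off of \<open>stft g f\<close> to \<open>K\<close>; hence the error of the truncated reconstruction is controlled by the \<open>L\<^sup>2\<close> mass
  of \<open>stft g f\<close> outside \<open>K\<close>. The iterated version follows from Fourier inversion on almost every
  slice whose transform is integrable.
\<close>

section \<open>The measure \<open>mu\<close> and the Gaussian\<close>

text \<open>In general \<open>stft g f\<close> is square-integrable but not integrable on phase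
  space, so the synthesis integral need not exist as a Lebesgue integral over both variables; it is
  read as a limit of cut-off integrals, or as an iterated integral under an integrability premise.
  The second obstacle is noncommutativity: the exponentials in i and j stand on opposite sides of
  the values and cannot be moved past them. Everything is therefore done over the reals: the kernel
  is an orthogonal map of a four-dimensional space, duality refers to the real inner product, and
  real polarisation is enough. A real window is central and slides out as a scalar. The factor (2
  pi)^(-n/2) in \<open>mu\<close> makes the Gaussian its own transform, so Plancherel carries no
  constant and the only constant left at the end is the squared norm of the window.\<close>

lemma sets_mu [simp, measurable_cong]: "sets (mu :: 'a::euclidean_space measure) = sets borel"
  by (simp add: mu_def)

lemma space_mu [simp]: "space (mu :: 'a::euclidean_space measure) = UNIV"
  by (simp add: mu_def)

lemma mu_constant_pos: "1 / (2 * pi) powr (real DIM('a::euclidean_space) / 2) > 0"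
  by simp

lemma integrable_scaleR_iff:
  fixes f :: "'a \<Rightarrow> 'b::{banach, second_countable_topology}" and c :: real
  assumes "c \<noteq> 0"
  shows "integrable M (\<lambda>x. c *\<^sub>R f x) \<longleftrightarrow> integrable M f"
proof
  assume "integrable M (\<lambda>x. c *\<^sub>R f x)"
  then have "integrable M (\<lambda>x. inverse c *\<^sub>R c *\<^sub>R f x)"
    by (rule integrable_scaleR_right)
  with assms show "integrable M f" by simp
qed simp

lemma AE_mu_iff: "(AE x in (mu :: 'a::euclidean_space measure). P x) \<longleftrightarrow> (AE x in lborel. P x)"
  unfolding mu_def by (subst AE_density) auto

lemma integrable_mu_iff:
  fixes f :: "'a::euclidean_space \<Rightarrow> 'b::{banach, second_countable_topology}"
  assumes "f \<in> borel_measurable borel"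
  shows "integrable mu f \<longleftrightarrow> integrable lborel f"
  using assms mu_constant_pos[where ?'a = 'a]
  by (simp add: mu_def integrable_density integrable_scaleR_iff)

lemma integral_mu:
  fixes f :: "'a::euclidean_space \<Rightarrow> 'b::{banach, second_countable_topology}"
  assumes "f \<in> borel_measurable borel"
  shows "integral\<^sup>L mu f = (1 / (2 * pi) powr (real DIM('a) / 2)) *\<^sub>R integral\<^sup>L lborel f"
  using assms mu_constant_pos[where ?'a = 'a]
  by (simp add: mu_def integral_density)

lemma emeasure_mu:
  assumes "A \<in> sets borel"
  shows "emeasure (mu :: 'a::euclidean_space measure) A
    = ennreal (1 / (2 * pi) powr (real DIM('a) / 2)) * emeasure lborel A"
  using assms by (simp add: mu_def emeasure_density nn_integral_cmult_indicator)

lemma emeasure_mu_bounded_finite: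
  fixes A :: "'a::euclidean_space set"
  assumes "bounded A" "A \<in> sets borel"
  shows "emeasure mu A < \<infinity>"
  using assms emeasure_bounded_finite[OF assms(1)]
  by (simp add: emeasure_mu ennreal_mult_less_top del: ennreal_1)

interpretation mu: sigma_finite_measure "mu :: 'a::euclidean_space measure"
proof
  have "emeasure (mu :: 'a measure) (cball 0 (real n)) \<noteq> \<infinity>" for n
    using emeasure_mu_bounded_finite[of "cball (0::'a) (real n)"] by (simp add: less_top)
  moreover have "(\<Union>n. cball (0::'a) (real n)) = UNIV"
    using real_arch_simple by auto
  ultimately show "\<exists>A. countable A \<and> A \<subseteq> sets (mu :: 'a measure) \<and> \<Union> A = space mu \<and> (\<forall>a\<in>A. emeasure mu a \<noteq> \<infinity>)"
    by (intro exI[of _ "range (\<lambda>n. cball (0::'a) (real n))"]) auto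
qed

interpretation mu2: pair_sigma_finite "mu :: 'a::euclidean_space measure" "mu :: 'b::euclidean_space measure"
  by unfold_locales

lemma sets_mu_pair [simp]:
  "sets ((mu :: 'a::euclidean_space measure) \<Otimes>\<^sub>M (mu :: 'b::euclidean_space measure)) = sets borel"
  by (simp add: borel_prod[symmetric] cong: sets_pair_measure_cong)

lemma space_mu_pair [simp]:
  "space ((mu :: 'a::euclidean_space measure) \<Otimes>\<^sub>M (mu :: 'b::euclidean_space measure)) = UNIV"
  by (simp add: space_pair_measure)

text \<open>Rectangles have an explicit product measure, so \<open>K\<close> is enclosed in the
  rectangle of its projections, which are again compact.\<close>

lemma emeasure_mu_pair_compact_finite:
  fixes K :: "('a::euclidean_space \<times> 'b::euclidean_space) set"
  assumes "compact K"
  shows "emeasure (mu \<Otimes>\<^sub>M mu) K < \<infinity>"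
proof -
  have c: "compact (fst ` K)" "compact (snd ` K)"
    using assms by (auto intro!: compact_continuous_image continuous_intros)
  have "emeasure (mu \<Otimes>\<^sub>M mu) K \<le> emeasure (mu \<Otimes>\<^sub>M mu) (fst ` K \<times> snd ` K)"
  proof (rule emeasure_mono)
    show "K \<subseteq> fst ` K \<times> snd ` K" by force
  qed (use c in \<open>auto intro!: borel_closed closed_Times compact_imp_closed\<close>)
  also have "\<dots> = emeasure mu (fst ` K) * emeasure mu (snd ` K)"
    by (rule mu.emeasure_pair_measure_Times) (use c in \<open>auto intro!: borel_closed compact_imp_closed\<close>)
  also have "\<dots> < \<infinity>"
    using c emeasure_mu_bounded_finite[of "fst ` K"] emeasure_mu_bounded_finite[of "snd ` K"]
    by (auto simp: ennreal_mult_less_top compact_imp_bounded borel_closed compact_imp_closed)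
  finally show ?thesis .
qed

section \<open>Affine changes of variables, translations and reflections\<close>

lemma integrable_mu_affine_iff:
  fixes f :: "'a::euclidean_space \<Rightarrow> 'b::{banach, second_countable_topology}"
  assumes [measurable]: "f \<in> borel_measurable borel" and "c \<noteq> 0"
  shows "integrable mu (\<lambda>x. f (t + c *\<^sub>R x)) \<longleftrightarrow> integrable mu f"
proof -
  have "integrable lborel f \<longleftrightarrow> integrable (density (distr lborel borel (\<lambda>x. t + c *\<^sub>R x)) (\<lambda>_. ennreal (\<bar>c\<bar>^DIM('a)))) f"
    using assms(2) by (subst lborel_affine[of c t]) (auto)
  also have "\<dots> \<longleftrightarrow> integrable lborel (\<lambda>x. f (t + c *\<^sub>R x))"
    using assms(2) by (simp add: integrable_density integrable_distr_eq integrable_scaleR_iff)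
  finally show ?thesis
    by (simp add: integrable_mu_iff)
qed

lemma integral_mu_affine:
  fixes f :: "'a::euclidean_space \<Rightarrow> 'b::{banach, second_countable_topology}"
  assumes [measurable]: "f \<in> borel_measurable borel" and "c \<noteq> 0"
  shows "integral\<^sup>L mu f = \<bar>c\<bar>^DIM('a) *\<^sub>R (LINT x|mu. f (t + c *\<^sub>R x))"
proof -
  have "integral\<^sup>L lborel f = integral\<^sup>L (density (distr lborel borel (\<lambda>x. t + c *\<^sub>R x)) (\<lambda>_. ennreal (\<bar>c\<bar>^DIM('a)))) f"
    using assms(2) by (subst lborel_affine[of c t]) (auto)
  also have "\<dots> = \<bar>c\<bar>^DIM('a) *\<^sub>R integral\<^sup>L lborel (\<lambda>x. f (t + c *\<^sub>R x))"
    using assms(2) by (simp add: integral_density integral_distr)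
  finally show ?thesis
    by (simp add: integral_mu mult.commute)
qed

lemma 
  fixes f :: "'a::euclidean_space \<Rightarrow> 'b::{banach, second_countable_topology}"
  assumes [measurable]: "f \<in> borel_measurable borel"
  shows integrable_mu_translate: "integrable mu (\<lambda>x. f (x - a)) \<longleftrightarrow> integrable mu f"
    and integral_mu_translate: "(LINT x|mu. f (x - a)) = integral\<^sup>L mu f"
    and integrable_mu_reflect: "integrable mu (\<lambda>x. f (a - x)) \<longleftrightarrow> integrable mu f"
    and integral_mu_reflect: "(LINT x|mu. f (a - x)) = integral\<^sup>L mu f"
  using integrable_mu_affine_iff[OF assms, of 1 "-a"] integral_mu_affine[OF assms, of 1 "-a"]
    integrable_mu_affine_iff[OF assms, of "-1" "a"] integral_mu_affine[OF assms, of "-1" "a"]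
  by simp_all

text \<open>Unnormalised, because the factor in \<open>mu\<close> already contains the power of 2 pi
  that gives it total mass 1.\<close>

definition gau :: "'a::euclidean_space \<Rightarrow> real" where
  "gau w = exp (- (norm w)\<^sup>2 / 2)"

lemma borel_measurable_gau [measurable]: "gau \<in> borel_measurable borel"
  unfolding gau_def[abs_def] by measurable

lemma gau_pos [simp]: "gau w > 0" "gau w \<ge> 0" and gau_le_1: "gau w \<le> 1"
  by (simp_all add: gau_def)

text \<open>This is the characteristic function of the standard normal distribution with its density
  written out.\<close>

lemma integral_cis_std_normal:
  "integrable lborel (\<lambda>x. cis (t * x) * complex_of_real (exp (- x\<^sup>2 / 2)))" (is ?I)
  "(LINT x|lborel. cis (t * x) * complex_of_real (exp (- x\<^sup>2 / 2)))
     = complex_of_real (sqrt (2 * pi) * exp (- t\<^sup>2 / 2))" (is ?E)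
proof -
  have "char std_normal_distribution t
      = (LINT x|lborel. std_normal_density x *\<^sub>R iexp (t * x))"
    unfolding char_def by (subst integral_density) auto
  also have "(\<lambda>x. std_normal_density x *\<^sub>R iexp (t * x))
     = (\<lambda>x. complex_of_real (1 / sqrt (2 * pi)) * (cis (t * x) * complex_of_real (exp (- x\<^sup>2 / 2))))"
    by (auto simp: fun_eq_iff std_normal_density_def cis_conv_exp scaleR_conv_of_real mult_ac)
  finally have "complex_of_real (exp (- (t^2) / 2)) =
     complex_of_real (1 / sqrt (2 * pi)) * (LINT x|lborel. cis (t * x) * complex_of_real (exp (- x\<^sup>2 / 2)))"
    by (simp add: char_std_normal_distribution)
  then show ?E
    by (simp add: field_simps)
  have "integrable lborel (\<lambda>x. sqrt (2 * pi) * std_normal_density x)"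
    by (intro integrable_mult_right) simp
  then have "integrable lborel (\<lambda>x. exp (- x\<^sup>2 / 2) :: real)"
    by (simp add: std_normal_density_def)
  then show ?I
    by (rule Bochner_Integration.integrable_bound) (auto simp: norm_mult cis_conv_exp)
qed

lemma gau_cis_prod:
  fixes a w :: "'a::euclidean_space"
  shows "cis (a \<bullet> w) * complex_of_real (gau w)
     = (\<Prod>b\<in>Basis. cis ((a \<bullet> b) * (w \<bullet> b)) * complex_of_real (exp (- (w \<bullet> b)\<^sup>2 / 2)))"
proof -
  have "cis (a \<bullet> w) = (\<Prod>b\<in>Basis. cis ((a \<bullet> b) * (w \<bullet> b)))"
    by (subst euclidean_inner) (simp add: cis_conv_exp exp_sum[symmetric] sum_distrib_left)
  moreover have "gau w = (\<Prod>b\<in>Basis. exp (- (w \<bullet> b)\<^sup>2 / 2))"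
    unfolding gau_def power2_norm_eq_inner by (subst euclidean_inner[of w w]) (simp add: exp_sum[symmetric] sum_negf sum_divide_distrib power2_eq_square)
  ultimately show ?thesis
    by (simp add: prod.distrib)
qed

text \<open>By \<open>lborel_eq\<close>, Lebesgue measure is an image of a product of
  one-dimensional ones, and the integrand factors over the basis by \<open>gau_cis_prod\<close>.
  Each coordinate contributes sqrt(2 pi), and together these cancel the normalisation of
  \<open>mu\<close>.\<close>

lemma
  fixes a :: "'a::euclidean_space"
  shows integrable_gau_cis: "integrable mu (\<lambda>w::'a. cis (a \<bullet> w) * complex_of_real (gau w))" (is ?I)
    and integral_gau_cis: "(LINT w|mu. cis (a \<bullet> w) * complex_of_real (gau w)) = complex_of_real (gau a)" (is ?E)
proof -
  interpret product_sigma_finite "\<lambda>_::'a. lborel :: real measure"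
    by unfold_locales
  let ?h = "\<lambda>b x. cis ((a \<bullet> b) * x) * complex_of_real (exp (- x\<^sup>2 / 2))"
  have m[measurable]: "(\<lambda>w::'a. cis (a \<bullet> w)) \<in> borel_measurable borel"
    unfolding cis_conv_exp by measurable
  have *: "cis (a \<bullet> (\<Sum>b\<in>Basis. f b *\<^sub>R b)) * complex_of_real (gau (\<Sum>b\<in>Basis. f b *\<^sub>R b))
      = (\<Prod>b\<in>Basis. ?h b (f b))" for f :: "'a \<Rightarrow> real"
    unfolding gau_cis_prod by (intro prod.cong) (auto simp: inner_sum_left_Basis)
  have "integrable lborel (\<lambda>w::'a. cis (a \<bullet> w) * complex_of_real (gau w))"
    unfolding lborel_eq[where 'a='a]
    by (subst integrable_distr_eq) (auto simp: * intro!: product_integrable_prod integral_cis_std_normal[simplified])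
  then show ?I
    by (subst integrable_mu_iff) auto
  have "(LINT w|lborel. cis (a \<bullet> w) * complex_of_real (gau w)) = (\<Prod>b\<in>Basis. integral\<^sup>L lborel (?h b))"
    unfolding lborel_eq[where 'a='a]
    by (subst integral_distr) (auto simp: * intro!: product_integral_prod integral_cis_std_normal[simplified])
  also have "\<dots> = complex_of_real ((\<Prod>b\<in>(Basis::'a set). sqrt (2 * pi)) * (\<Prod>b\<in>Basis. exp (- (a \<bullet> b)\<^sup>2 / 2)))"
    unfolding integral_cis_std_normal by (simp add: prod.distrib)
  also have "(\<Prod>b\<in>Basis. exp (- (a \<bullet> b)\<^sup>2 / 2)) = gau a"
    unfolding gau_def power2_norm_eq_inner by (subst euclidean_inner[of a a]) (simp add: exp_sum[symmetric] sum_negf sum_divide_distrib power2_eq_square)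
  also have "(\<Prod>b\<in>(Basis::'a set). sqrt (2 * pi)) = (2 * pi) powr (real DIM('a) / 2)"
    by (simp add: powr_half_sqrt[symmetric] powr_realpow[symmetric] powr_powr del: powr_realpow)
  finally show ?E
    by (subst integral_mu) (auto simp: scaleR_conv_of_real)
qed

section \<open>Square-integrable functions and continuity of translations\<close>

lemma square_integrableD:
  assumes "square_integrable f"
  shows "f \<in> borel_measurable borel" "integrable mu (\<lambda>x. (norm (f x))\<^sup>2)"
  using assms unfolding square_integrable_def by (simp_all add: measurable_cong_sets[OF sets_mu refl])

lemma square_integrableI:
  assumes "f \<in> borel_measurable borel" "integrable mu (\<lambda>x. (norm (f x))\<^sup>2)"
  shows "square_integrable f"
  using assms unfolding square_integrable_def by (simp add: measurable_cong_sets[OF sets_mu refl])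

lemma norm_sq_add_le: "(norm (a + b :: 'a::real_normed_vector))\<^sup>2 \<le> 2 * (norm a)\<^sup>2 + 2 * (norm b)\<^sup>2"
proof -
  have "(norm (a + b))\<^sup>2 \<le> (norm a + norm b)\<^sup>2"
    by (intro power_mono norm_triangle_ineq) auto
  also have "\<dots> \<le> 2 * (norm a)\<^sup>2 + 2 * (norm b)\<^sup>2"
    using sum_squares_bound[of "norm a" "norm b"] by (simp add: power2_sum)
  finally show ?thesis .
qed

lemma norm_sq_diff_le: "(norm (a - b :: 'a::real_normed_vector))\<^sup>2 \<le> 2 * (norm a)\<^sup>2 + 2 * (norm b)\<^sup>2"
  using norm_sq_add_le[of a "-b"] by simp

text \<open>Stands in for the integral Cauchy-Schwarz inequality: a product of two L2 functions is
  dominated by the sum of their squares, so its integrability follows by domination.\<close>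

lemma abs_mult_le_sum_squares: "\<bar>a\<bar> * \<bar>b\<bar> \<le> a\<^sup>2 + b\<^sup>2" for a b :: real
  using sum_squares_bound[of "\<bar>a\<bar>" "\<bar>b\<bar>"] zero_le_power2[of a] zero_le_power2[of b]
  unfolding power2_abs by linarith

lemma abs_inner_le_norm_squares: "\<bar>a \<bullet> b\<bar> \<le> (norm a)\<^sup>2 + (norm b)\<^sup>2"
  using Cauchy_Schwarz_ineq2[of a b] abs_mult_le_sum_squares[of "norm a" "norm b"] by simp

lemma square_integrable_dominated:
  fixes f :: "'a::euclidean_space \<Rightarrow> 'b::{real_normed_vector,second_countable_topology}"
  assumes "f \<in> borel_measurable borel" "integrable mu g" "\<And>x. (norm (f x))\<^sup>2 \<le> g x"
  shows "square_integrable f"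
proof (rule square_integrableI)
  show "integrable mu (\<lambda>x. (norm (f x))\<^sup>2)"
  proof (rule Bochner_Integration.integrable_bound[OF assms(2)])
    show "(\<lambda>x. (norm (f x))\<^sup>2) \<in> borel_measurable mu"
      using assms(1) by measurable
    have "(norm (f x))\<^sup>2 \<le> \<bar>g x\<bar>" for x
      using assms(3)[of x] by linarith
    then show "AE x in mu. norm ((norm (f x))\<^sup>2) \<le> norm (g x)"
      by simp
  qed
qed fact

lemma
  fixes f g :: "'a::euclidean_space \<Rightarrow> 'b::{real_normed_vector,second_countable_topology}"
  assumes "square_integrable f" "square_integrable g"
  shows square_integrable_add: "square_integrable (\<lambda>x. f x + g x)"
    and square_integrable_diff: "square_integrable (\<lambda>x. f x - g x)"
proof -
  note [measurable] = square_integrableD(1)[OF assms(1)] square_integrableD(1)[OF assms(2)]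
  have "integrable mu (\<lambda>x. 2 * (norm (f x))\<^sup>2 + 2 * (norm (g x))\<^sup>2)"
    using assms by (intro Bochner_Integration.integrable_add integrable_mult_right square_integrableD)
  then show "square_integrable (\<lambda>x. f x + g x)" "square_integrable (\<lambda>x. f x - g x)"
    by (auto intro!: square_integrable_dominated norm_sq_diff_le norm_sq_add_le)
qed

lemma square_integrable_scaleR:
  fixes f :: "'a::euclidean_space \<Rightarrow> 'b::{real_normed_vector,second_countable_topology}"
  assumes "square_integrable f"
  shows "square_integrable (\<lambda>x. (c::real) *\<^sub>R f x)"
proof (rule square_integrable_dominated)
  show "integrable mu (\<lambda>x. c\<^sup>2 * (norm (f x))\<^sup>2)"
    using assms by (intro integrable_mult_right square_integrableD)
qed (use square_integrableD[OF assms] in \<open>auto simp: power_mult_distrib\<close>)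

lemma square_integrable_translate:
  fixes f :: "'a::euclidean_space \<Rightarrow> 'b::{real_normed_vector,second_countable_topology}"
  assumes "square_integrable f"
  shows "square_integrable (\<lambda>x. f (x - a))"
  using square_integrableD[OF assms] integrable_mu_translate[of "\<lambda>x. (norm (f x))\<^sup>2" a]
  by (auto intro!: square_integrableI)

lemma integrable_inner_square_integrable:
  fixes f g :: "'a::euclidean_space \<Rightarrow> 'b::euclidean_space"
  assumes "square_integrable f" "square_integrable g"
  shows "integrable mu (\<lambda>x. f x \<bullet> g x)" "integrable mu (\<lambda>x. norm (f x) * norm (g x))"
proof -
  note [measurable] = square_integrableD(1)[OF assms(1)] square_integrableD(1)[OF assms(2)]
  have i: "integrable mu (\<lambda>x. (norm (f x))\<^sup>2 + (norm (g x))\<^sup>2)"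
    using assms by (intro Bochner_Integration.integrable_add square_integrableD)
  show "integrable mu (\<lambda>x. norm (f x) * norm (g x))"
    by (rule Bochner_Integration.integrable_bound[OF i])
       (use abs_mult_le_sum_squares[of "norm (f _)" "norm (g _)"] in auto)
  show "integrable mu (\<lambda>x. f x \<bullet> g x)"
    by (rule Bochner_Integration.integrable_bound[OF i])
       (auto intro: abs_inner_le_norm_squares)
qed

lemma integrable_mu_bounded_support:
  fixes f :: "'a::euclidean_space \<Rightarrow> 'b::{banach,second_countable_topology}"
  assumes "f \<in> borel_measurable borel" "\<And>x. norm (f x) \<le> B" "\<And>x. norm x > R \<Longrightarrow> f x = 0"
  shows "integrable mu f"
proof (rule Bochner_Integration.integrable_bound)
  show "integrable mu (\<lambda>x::'a. B * indicator (cball 0 R) x)"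
    using emeasure_mu_bounded_finite[of "cball (0::'a) R"]
    by (intro integrable_mult_right integrable_real_indicator) auto
  have "0 \<le> B" using assms(2)[of undefined] norm_ge_zero order_trans by blast
  then show "AE x in mu. norm (f x) \<le> norm (B * indicator (cball 0 R) x)"
    using assms(2,3) by (auto split: split_indicator intro!: AE_I2)
qed (use assms in auto)

lemma square_integrable_bounded_support:
  fixes f :: "'a::euclidean_space \<Rightarrow> 'b::euclidean_space"
  assumes "f \<in> borel_measurable borel" "\<And>x. norm (f x) \<le> B" "\<And>x. norm x > R \<Longrightarrow> f x = 0"
  shows "square_integrable f"
proof (rule square_integrableI)
  show "integrable mu (\<lambda>x. (norm (f x))\<^sup>2)"
    by (rule integrable_mu_bounded_support[where B="B\<^sup>2" and R=R]) (use assms in \<open>auto intro!: power_mono\<close>)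
qed fact

text \<open>Cutting both the argument and the value leaves a bounded function of bounded support,
  hence in L1 and L2 even if \<open>f\<close> is merely measurable. It serves both as an
  approximation of \<open>f\<close> and as a test function against \<open>f\<close>.\<close>

definition truncate_to_ball :: "real \<Rightarrow> ('a::euclidean_space \<Rightarrow> 'b::euclidean_space) \<Rightarrow> 'a \<Rightarrow> 'b" where
  "truncate_to_ball r f x = (if norm x \<le> r \<and> norm (f x) \<le> r then f x else 0)"

lemma
  fixes f :: "'a::euclidean_space \<Rightarrow> 'b::euclidean_space"
  assumes "f \<in> borel_measurable borel" "0 \<le> r"
  shows borel_measurable_truncate_to_ball: "truncate_to_ball r f \<in> borel_measurable borel"
    and integrable_truncate_to_ball: "integrable mu (truncate_to_ball r f)"
    and square_integrable_truncate_to_ball: "square_integrable (truncate_to_ball r f)"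
proof -
  show *: "truncate_to_ball r f \<in> borel_measurable borel"
    unfolding truncate_to_ball_def[abs_def] using assms(1) by measurable
  have "norm (truncate_to_ball r f x) \<le> r" "norm x > r \<Longrightarrow> truncate_to_ball r f x = 0" for x
    using assms(2) by (auto simp: truncate_to_ball_def)
  then show "integrable mu (truncate_to_ball r f)" "square_integrable (truncate_to_ball r f)"
    using * integrable_mu_bounded_support square_integrable_bounded_support by blast+
qed

lemma truncate_to_ball_tendsto:
  fixes f :: "'a::euclidean_space \<Rightarrow> 'b::euclidean_space"
  shows "(\<lambda>n. truncate_to_ball (real n) f x) \<longlonglongrightarrow> f x"
proof (rule tendsto_eventually)
  obtain N where N: "real N \<ge> max (norm x) (norm (f x))"
    using real_arch_simple by blast
  show "\<forall>\<^sub>F n in sequentially. truncate_to_ball (real n) f x = f x"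
    by (rule eventually_sequentiallyI[of N]) (use N in \<open>auto simp: truncate_to_ball_def\<close>)
qed

lemma truncate_to_ball_L2_tendsto:
  fixes f :: "'a::euclidean_space \<Rightarrow> 'b::euclidean_space"
  assumes "square_integrable f"
  shows "(\<lambda>n. LINT x|mu. (norm (f x - truncate_to_ball (real n) f x))\<^sup>2) \<longlonglongrightarrow> 0"
proof -
  note f[measurable] = square_integrableD(1)[OF assms]
  have [measurable]: "truncate_to_ball (real n) f \<in> borel_measurable borel" for n
    by (rule borel_measurable_truncate_to_ball[OF f]) simp
  have "(\<lambda>n. LINT x|mu. (norm (f x - truncate_to_ball (real n) f x))\<^sup>2) \<longlonglongrightarrow> (LINT x::'a|mu. 0)"
  proof (rule integral_dominated_convergence[where w="\<lambda>x. (norm (f x))\<^sup>2"])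
    show "AE x in mu. (\<lambda>n. (norm (f x - truncate_to_ball (real n) f x))\<^sup>2) \<longlonglongrightarrow> 0"
      using truncate_to_ball_tendsto[of f] by (auto intro!: AE_I2 tendsto_eq_intros)
    show "AE x in mu. norm ((norm (f x - truncate_to_ball (real n) f x))\<^sup>2) \<le> (norm (f x))\<^sup>2" for n
      by (auto simp: truncate_to_ball_def)
  qed (use square_integrableD(2)[OF assms] in auto)
  then show ?thesis by simp
qed

text \<open>A bounded truncation \<open>t\<close> of \<open>f\<close> is an almost-everywhere limit
  of continuous functions; these are forced into a common ball in value and in support, so that
  dominated convergence upgrades the limit to L2.\<close>

lemma square_integrable_approx_continuous:
  fixes f :: "'a::euclidean_space \<Rightarrow> 'b::euclidean_space"
  assumes "square_integrable f" "0 < e"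
  obtains \<phi> B R where "continuous_on UNIV \<phi>" "\<And>x. norm (\<phi> x) \<le> B" "\<And>x. norm x > R \<Longrightarrow> \<phi> x = 0"
    "square_integrable \<phi>" "(LINT x|mu. (norm (f x - \<phi> x))\<^sup>2) < e"
proof -
  note f[measurable] = square_integrableD(1)[OF assms(1)]
  \<comment> \<open>Two errors below e/4, each doubled by \<open>norm_sq_add_le\<close>, add up to
    less than e.\<close>
  have "\<forall>\<^sub>F n in sequentially. (LINT x|mu. (norm (f x - truncate_to_ball (real n) f x))\<^sup>2) < e / 4"
    using truncate_to_ball_L2_tendsto[OF assms(1)] assms(2) by (intro order_tendstoD) auto
  then obtain N :: real where N: "(LINT x|mu. (norm (f x - truncate_to_ball N f x))\<^sup>2) < e / 4" and "0 \<le> N"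
    by (auto simp: eventually_sequentially)
  define t where "t = truncate_to_ball N f"
  have t[measurable]: "t \<in> borel_measurable borel" and tsq: "square_integrable t"
    unfolding t_def by (simp_all add: borel_measurable_truncate_to_ball square_integrable_truncate_to_ball \<open>0 \<le> N\<close>)
  have tb: "norm (t x) \<le> N" and t0: "norm x > N \<Longrightarrow> t x = 0" for x
    using \<open>0 \<le> N\<close> by (auto simp: t_def truncate_to_ball_def)
  have "t measurable_on UNIV"
    by (rule lebesgue_measurable_imp_measurable_on) (auto intro: measurable_completion)
  then obtain Z g where Z: "negligible Z" and gc: "\<And>n. continuous_on UNIV (g n)"
    and gt: "\<And>x. x \<notin> Z \<Longrightarrow> (\<lambda>n. g n x) \<longlonglongrightarrow> t x"
    unfolding measurable_on_def by auto
  \<comment> \<open>\<open>\<eta>\<close> is 1 on the ball of radius \<open>N\<close> and vanishes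
    beyond \<open>N + 1\<close>, so it bounds the support without changing \<open>t\<close>; the
    projection \<open>p\<close> bounds the values by \<open>N\<close> and fixes those of
    \<open>t\<close>.\<close>
  define \<eta> :: "'a \<Rightarrow> real" where "\<eta> x = max 0 (min 1 (N + 1 - norm x))" for x
  define p :: "'b \<Rightarrow> 'b" where "p = closest_point (cball 0 N)"
  have pc: "continuous_on UNIV p"
    unfolding p_def by (rule continuous_on_closest_point) (use \<open>0 \<le> N\<close> in auto)
  have pb: "norm (p v) \<le> N" for v
    using \<open>0 \<le> N\<close> closest_point_in_set[of "cball (0::'b) N" v] by (simp add: p_def)
  have pid: "norm v \<le> N \<Longrightarrow> p v = v" for v
    unfolding p_def by (intro closest_point_self) auto
  define \<phi> where "\<phi> n x = \<eta> x *\<^sub>R p (g n x)" for n x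
  have \<phi>c: "continuous_on UNIV (\<phi> n)" for n
    unfolding \<phi>_def \<eta>_def
    by (intro continuous_intros continuous_on_compose2[OF pc] gc) auto
  then have [measurable]: "\<phi> n \<in> borel_measurable borel" for n
    by (rule borel_measurable_continuous_onI)
  have \<phi>b: "norm (\<phi> n x) \<le> N" for n x
    using mult_mono[of "\<bar>\<eta> x\<bar>" 1 "norm (p (g n x))" N] pb[of "g n x"] by (auto simp: \<phi>_def \<eta>_def)
  have \<phi>0: "norm x > N + 1 \<Longrightarrow> \<phi> n x = 0" for n x
    by (simp add: \<phi>_def \<eta>_def)
  have \<phi>sq: "square_integrable (\<phi> n)" for n
    using \<phi>b \<phi>0 by (intro square_integrable_bounded_support) auto
  have lim: "(\<lambda>n. \<phi> n x) \<longlonglongrightarrow> t x" if "x \<notin> Z" for x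
  proof -
    have "(\<lambda>n. p (g n x)) \<longlonglongrightarrow> p (t x)"
      by (rule continuous_on_tendsto_compose[OF pc gt[OF that]]) auto
    then have "(\<lambda>n. \<phi> n x) \<longlonglongrightarrow> \<eta> x *\<^sub>R t x"
      unfolding \<phi>_def using pid[OF tb] by (auto intro!: tendsto_eq_intros)
    moreover have "\<eta> x *\<^sub>R t x = t x"
      by (cases "norm x > N") (auto simp: t0 \<eta>_def)
    ultimately show ?thesis by simp
  qed
  have "(\<lambda>n. LINT x|mu. (norm (t x - \<phi> n x))\<^sup>2) \<longlonglongrightarrow> (LINT x::'a|mu. 0)"
  proof (rule integral_dominated_convergence[where w="\<lambda>x. (2 * N)\<^sup>2 * indicator (cball 0 (N + 1)) x"])
    show "integrable mu (\<lambda>x::'a. (2 * N)\<^sup>2 * indicator (cball 0 (N + 1)) x :: real)"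
      using emeasure_mu_bounded_finite[of "cball (0::'a) (N + 1)"]
      by (intro integrable_mult_right integrable_real_indicator) auto
    have "AE x in lebesgue. x \<notin> Z"
      using Z by (simp add: negligible_iff_null_sets AE_not_in)
    then have "AE x in lborel. x \<notin> Z"
      by (simp add: AE_completion_iff)
    then show "AE x in mu. (\<lambda>n. (norm (t x - \<phi> n x))\<^sup>2) \<longlonglongrightarrow> 0"
      unfolding AE_mu_iff by eventually_elim (use lim in \<open>auto intro!: tendsto_eq_intros\<close>)
    show "AE x in mu. norm ((norm (t x - \<phi> n x))\<^sup>2) \<le> (2 * N)\<^sup>2 * indicator (cball 0 (N + 1)) x" for n
    proof (rule AE_I2)
      fix x
      have "norm (t x - \<phi> n x) \<le> 2 * N"
        using norm_triangle_ineq4[of "t x" "\<phi> n x"] tb[of x] \<phi>b[of n x] by linarith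
      then have "(norm (t x - \<phi> n x))\<^sup>2 \<le> (2 * N)\<^sup>2"
        using power_mono[of "norm (t x - \<phi> n x)" "2 * N" 2] by simp
      then show "norm ((norm (t x - \<phi> n x))\<^sup>2) \<le> (2 * N)\<^sup>2 * indicator (cball 0 (N + 1)) x"
        using t0[of x] \<phi>0[of x n] by (auto split: split_indicator)
    qed
  qed auto
  then have "\<forall>\<^sub>F n in sequentially. (LINT x|mu. (norm (t x - \<phi> n x))\<^sup>2) < e / 4"
    using assms(2) by (intro order_tendstoD) auto
  then obtain n where n: "(LINT x|mu. (norm (t x - \<phi> n x))\<^sup>2) < e / 4"
    by (auto simp: eventually_sequentially)
  have i1: "integrable mu (\<lambda>x. (norm (f x - t x))\<^sup>2)" and i2: "integrable mu (\<lambda>x. (norm (t x - \<phi> n x))\<^sup>2)"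
    and i3: "integrable mu (\<lambda>x. (norm (f x - \<phi> n x))\<^sup>2)"
    using assms(1) tsq \<phi>sq by (auto intro!: square_integrableD(2) square_integrable_diff)
  have "(LINT x|mu. (norm (f x - \<phi> n x))\<^sup>2) \<le> (LINT x|mu. 2 * (norm (f x - t x))\<^sup>2 + 2 * (norm (t x - \<phi> n x))\<^sup>2)"
  proof (intro integral_mono i3 Bochner_Integration.integrable_add integrable_mult_right i1 i2)
    show "(norm (f x - \<phi> n x))\<^sup>2 \<le> 2 * (norm (f x - t x))\<^sup>2 + 2 * (norm (t x - \<phi> n x))\<^sup>2" for x
      using norm_sq_add_le[of "f x - t x" "t x - \<phi> n x"] by simp
  qed
  also have "\<dots> = 2 * (LINT x|mu. (norm (f x - t x))\<^sup>2) + 2 * (LINT x|mu. (norm (t x - \<phi> n x))\<^sup>2)"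
    using i1 i2 by simp
  also have "\<dots> < e"
    using N n by (simp add: t_def)
  finally show ?thesis
    using that[of "\<phi> n" N "N + 1"] \<phi>c \<phi>b \<phi>0 \<phi>sq by auto
qed

lemma L2_translation_continuous:
  fixes f :: "'a::euclidean_space \<Rightarrow> 'b::euclidean_space"
  assumes f: "square_integrable f" and z: "z \<longlonglongrightarrow> 0"
  shows "(\<lambda>n. LINT x|mu. (norm (f x - f (x - z n)))\<^sup>2) \<longlonglongrightarrow> 0"
proof (rule tendstoI)
  fix e :: real assume e: "0 < e"
  \<comment> \<open>The final estimate is 4 e/32 + 4 e/32 + 2 e/4 = 3 e/4, below e.\<close>
  obtain \<phi> B R where \<phi>: "continuous_on UNIV \<phi>" "\<And>x. norm (\<phi> x) \<le> B" "\<And>x. norm x > R \<Longrightarrow> \<phi> x = 0"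
    "square_integrable \<phi>" "(LINT x|mu. (norm (f x - \<phi> x))\<^sup>2) < e / 32"
    using square_integrable_approx_continuous[OF f, of "e / 32"] e by auto
  note [measurable] = square_integrableD(1)[OF f] square_integrableD(1)[OF \<phi>(4)]
  \<comment> \<open>Convergent shifts are bounded, so all shifted copies of \<open>\<phi>\<close>
    vanish outside the ball of radius \<open>R + C\<close>; this gives one integrable
    majorant.\<close>
  obtain C where C: "\<And>n. norm (z n) \<le> C"
    using convergent_imp_Bseq[OF convergentI[OF z]] by (auto simp: Bseq_def)
  have "(\<lambda>n. LINT x|mu. (norm (\<phi> x - \<phi> (x - z n)))\<^sup>2) \<longlonglongrightarrow> (LINT x::'a|mu. 0)"
  proof (rule integral_dominated_convergence[where w="\<lambda>x. (2 * B)\<^sup>2 * indicator (cball 0 (R + C)) x"])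
    show "integrable mu (\<lambda>x::'a. (2 * B)\<^sup>2 * indicator (cball 0 (R + C)) x)"
      using emeasure_mu_bounded_finite[of "cball (0::'a) (R + C)"]
      by (intro integrable_mult_right integrable_real_indicator) auto
    show "AE x in mu. (\<lambda>n. (norm (\<phi> x - \<phi> (x - z n)))\<^sup>2) \<longlonglongrightarrow> 0"
    proof (rule AE_I2)
      fix x
      have "(\<lambda>n. x - z n) \<longlonglongrightarrow> x"
        using z by (auto intro!: tendsto_eq_intros)
      then have "(\<lambda>n. \<phi> (x - z n)) \<longlonglongrightarrow> \<phi> x"
        by (rule continuous_on_tendsto_compose[OF \<phi>(1)]) auto
      then show "(\<lambda>n. (norm (\<phi> x - \<phi> (x - z n)))\<^sup>2) \<longlonglongrightarrow> 0"
        by (auto intro!: tendsto_eq_intros)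
    qed
    show "AE x in mu. norm ((norm (\<phi> x - \<phi> (x - z n)))\<^sup>2) \<le> (2 * B)\<^sup>2 * indicator (cball 0 (R + C)) x" for n
    proof (rule AE_I2)
      fix x
      have "norm (\<phi> x - \<phi> (x - z n)) \<le> 2 * B"
        using norm_triangle_ineq4[of "\<phi> x" "\<phi> (x - z n)"] \<phi>(2)[of x] \<phi>(2)[of "x - z n"] by linarith
      then have "(norm (\<phi> x - \<phi> (x - z n)))\<^sup>2 \<le> (2 * B)\<^sup>2"
        by (intro power_mono) auto
      moreover have "\<phi> x = 0" "\<phi> (x - z n) = 0" if "norm x > R + C"
        using that \<phi>(3)[of x] \<phi>(3)[of "x - z n"] C[of n] norm_triangle_ineq2[of x "z n"] norm_ge_zero[of "z n"]
        by linarith+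
      ultimately show "norm ((norm (\<phi> x - \<phi> (x - z n)))\<^sup>2) \<le> (2 * B)\<^sup>2 * indicator (cball 0 (R + C)) x"
        by (auto split: split_indicator)
    qed
  qed auto
  then have "\<forall>\<^sub>F n in sequentially. (LINT x|mu. (norm (\<phi> x - \<phi> (x - z n)))\<^sup>2) < e / 4"
    using e by (intro order_tendstoD) auto
  then show "\<forall>\<^sub>F n in sequentially. dist (LINT x|mu. (norm (f x - f (x - z n)))\<^sup>2) 0 < e"
  proof eventually_elim
    case (elim n)
    have i: "integrable mu (\<lambda>x. (norm (f x - f (x - z n)))\<^sup>2)" "integrable mu (\<lambda>x. (norm (f x - \<phi> x))\<^sup>2)"
      "integrable mu (\<lambda>x. (norm (\<phi> x - \<phi> (x - z n)))\<^sup>2)" "integrable mu (\<lambda>x. (norm (f (x - z n) - \<phi> (x - z n)))\<^sup>2)"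
      using f \<phi>(4) by (auto intro!: square_integrableD(2) square_integrable_diff square_integrable_translate)
    have "(LINT x|mu. (norm (f x - f (x - z n)))\<^sup>2) \<le>
      (LINT x|mu. 4 * (norm (f x - \<phi> x))\<^sup>2 + 4 * (norm (f (x - z n) - \<phi> (x - z n)))\<^sup>2 + 2 * (norm (\<phi> x - \<phi> (x - z n)))\<^sup>2)"
    proof (intro integral_mono i Bochner_Integration.integrable_add integrable_mult_right)
      fix x
      show "(norm (f x - f (x - z n)))\<^sup>2 \<le> 4 * (norm (f x - \<phi> x))\<^sup>2 + 4 * (norm (f (x - z n) - \<phi> (x - z n)))\<^sup>2 + 2 * (norm (\<phi> x - \<phi> (x - z n)))\<^sup>2"
        using norm_sq_add_le[of "(f x - \<phi> x) - (f (x - z n) - \<phi> (x - z n))" "\<phi> x - \<phi> (x - z n)"]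
          norm_sq_diff_le[of "f x - \<phi> x" "f (x - z n) - \<phi> (x - z n)"] by simp
    qed
    also have "\<dots> = 4 * (LINT x|mu. (norm (f x - \<phi> x))\<^sup>2) + 4 * (LINT x|mu. (norm (f (x - z n) - \<phi> (x - z n)))\<^sup>2)
         + 2 * (LINT x|mu. (norm (\<phi> x - \<phi> (x - z n)))\<^sup>2)"
      using i by simp
    also have "(LINT x|mu. (norm (f (x - z n) - \<phi> (x - z n)))\<^sup>2) = (LINT x|mu. (norm (f x - \<phi> x))\<^sup>2)"
      by (rule integral_mu_translate) measurable
    finally show ?case
      using elim \<phi>(5) e by (simp add: abs_of_nonneg)
  qed
qed

section \<open>The two-sided quaternion Fourier transform\<close>

text \<open>Since \<open>u\<close> squares to -1, \<open>\<phi>\<close> is a continuous algebra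
  homomorphism from the complex numbers that sends the imaginary unit to \<open>u\<close>; it
  carries the exponential series, and with it Euler's formula, over to the algebra.\<close>

lemma exp_scaleR_square_minus_one:
  fixes u :: "'a::{real_normed_algebra_1,banach}"
  assumes "u * u = - 1"
  shows "exp (t *\<^sub>R u) = cos t *\<^sub>R 1 + sin t *\<^sub>R u"
proof -
  define \<phi> where "\<phi> z = Re z *\<^sub>R 1 + Im z *\<^sub>R u" for z
  interpret \<phi>: bounded_linear \<phi>
    unfolding \<phi>_def
    by (intro bounded_linear_intros bounded_linear_compose[OF bounded_linear_scaleR_left] bounded_linear_Re bounded_linear_Im)
  have mult: "\<phi> (a * b) = \<phi> a * \<phi> b" for a b
    using assms by (simp add: \<phi>_def algebra_simps)
  have one: "\<phi> 1 = 1" by (simp add: \<phi>_def)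
  have pow: "\<phi> (z ^ n) = \<phi> z ^ n" for z n
    by (induction n) (simp_all add: mult one)
  have "(\<lambda>n. \<phi> ((\<i> * of_real t) ^ n /\<^sub>R fact n)) sums \<phi> (exp (\<i> * of_real t))"
    by (intro \<phi>.sums exp_converges)
  then have "(\<lambda>n. \<phi> (\<i> * of_real t) ^ n /\<^sub>R fact n) sums \<phi> (exp (\<i> * of_real t))"
    by (simp add: \<phi>.scaleR pow)
  then have "exp (\<phi> (\<i> * of_real t)) = \<phi> (exp (\<i> * of_real t))"
    using exp_converges sums_unique2 by blast
  then show ?thesis
    by (simp add: \<phi>_def cis_conv_exp[symmetric])
qed

lemma exp_qi: "exp (t *\<^sub>R qi) = Quat (cos t) (sin t) 0 0"
  and exp_qj: "exp (t *\<^sub>R qj) = Quat (cos t) 0 (sin t) 0"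
  by (simp_all add: exp_scaleR_square_minus_one quat_units)
     (simp_all add: qi_def qj_def one_quat_def quat_eq_iff)

text \<open>Both exponentials are treated as one real-linear map on the value between them, so that
  later arguments use only linearity, isometry, the group law and the adjoint. The signs are those
  of the synthesis; the forward transform uses \<open>twist (- y) w\<close>.\<close>

definition twist :: "'a::euclidean_space \<times> 'b::euclidean_space \<Rightarrow> 'a \<times> 'b \<Rightarrow> quat \<Rightarrow> quat" where
  "twist y w q = exp ((fst y \<bullet> fst w) *\<^sub>R qi) * q * exp ((snd y \<bullet> snd w) *\<^sub>R qj)"

lemma bounded_linear_twist: "bounded_linear (twist y w)"
  unfolding twist_def
  by (intro bounded_linear_intros bounded_linear_compose[OF bounded_linear_mult_left])

lemmas linear_twist = bounded_linear.linear[OF bounded_linear_twist]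
lemmas twist_add = linear_add[OF linear_twist]
lemmas twist_scaleR = linear_scale[OF linear_twist]

lemma norm_twist [simp]: "norm (twist y w q) = norm q"
  by (simp add: twist_def exp_qi exp_qj norm_mult) (simp add: norm_quat_def)

text \<open>Exponentials in \<open>qi\<close> meet only on the left of \<open>q\<close> and those in
  \<open>qj\<close> only on the right, so neither kind has to pass the other.\<close>

lemma twist_twist: "twist y w (twist y' w q) = twist (y + y') w q"
proof -
  have "exp (a *\<^sub>R u) * exp (b *\<^sub>R u) = exp ((a + b) *\<^sub>R u)" for a b and u :: quat
    by (simp add: scaleR_add_left exp_add_commuting)
  \<comment> \<open>On the right the inner exponential comes first, hence the swapped order of
    \<open>y'\<close> and \<open>y\<close> in the second instance.\<close>
  note * = this[of "fst y \<bullet> fst w" qi "fst y' \<bullet> fst w"] this[of "snd y' \<bullet> snd w" qj "snd y \<bullet> snd w"]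
  show ?thesis
    unfolding twist_def fst_add snd_add inner_add_left
    using * by (metis (no_types, lifting) mult.assoc add.commute)
qed

lemma inner_twist: "twist y w p \<bullet> q = p \<bullet> twist (- y) w q"
  unfolding twist_def fst_uminus snd_uminus inner_minus_left exp_qi exp_qj
  by (simp add: times_quat_def inner_quat_def algebra_simps)

lemma twist_scaleR_commute: "twist (c *\<^sub>R y) w q = twist y (c *\<^sub>R w) q"
  by (simp add: twist_def)

lemma borel_measurable_twist [measurable (raw)]:
  fixes f g :: "'m \<Rightarrow> 'a::euclidean_space \<times> 'b::euclidean_space"
  assumes [measurable]: "f \<in> borel_measurable M" "g \<in> borel_measurable M" "h \<in> borel_measurable M"
  shows "(\<lambda>x. twist (f x) (g x) (h x)) \<in> borel_measurable M"
proof -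
  have *: "(\<lambda>x. fst (k x)) \<in> borel_measurable M" "(\<lambda>x. snd (k x)) \<in> borel_measurable M"
    if "k \<in> borel_measurable M" for k :: "'m \<Rightarrow> 'a \<times> 'b"
    by (rule measurable_compose[OF that], rule borel_measurable_continuous_onI, intro continuous_intros)+
  note [measurable] = *[OF assms(1)] *[OF assms(2)]
  show ?thesis
    unfolding twist_def exp_scaleR_square_minus_one[OF quat_units(1)] exp_scaleR_square_minus_one[OF quat_units(2)]
    by measurable
qed

lemma (in pair_sigma_finite) integrable_mult_pair:
  fixes f :: "'a \<Rightarrow> real" and g :: "'b \<Rightarrow> real"
  assumes [simp]: "integrable M1 f" "integrable M2 g"
  shows "integrable (M1 \<Otimes>\<^sub>M M2) (\<lambda>(x, y). f x * g y)"
proof (rule Fubini_integrable)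
  show "integrable M1 (\<lambda>x. LINT y|M2. norm (case (x, y) of (x, y) \<Rightarrow> f x * g y))"
    by (simp add: abs_mult)
  have [measurable]: "f \<in> borel_measurable M1" "g \<in> borel_measurable M2"
    by (auto intro: borel_measurable_integrable)
  show "(\<lambda>(x, y). f x * g y) \<in> borel_measurable (M1 \<Otimes>\<^sub>M M2)"
    by measurable
qed auto

section \<open>Gaussian averages of the kernel\<close>

lemma
  fixes a :: "'a::euclidean_space"
  shows has_bochner_integral_gau_cos: "has_bochner_integral mu (\<lambda>w. gau w * cos (a \<bullet> w)) (gau a)"
    and has_bochner_integral_gau_sin: "has_bochner_integral mu (\<lambda>w. gau w * sin (a \<bullet> w)) 0"
proof -
  have "has_bochner_integral mu (\<lambda>w. cis (a \<bullet> w) * complex_of_real (gau w)) (complex_of_real (gau a))"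
    using integrable_gau_cis[of a] integral_gau_cis[of a] by (simp add: has_bochner_integral_iff)
  from has_bochner_integral_bounded_linear[OF bounded_linear_Re this]
    has_bochner_integral_bounded_linear[OF bounded_linear_Im this]
  show "has_bochner_integral mu (\<lambda>w. gau w * cos (a \<bullet> w)) (gau a)"
    "has_bochner_integral mu (\<lambda>w. gau w * sin (a \<bullet> w)) 0"
    by (simp_all add: mult.commute)
qed

lemma has_bochner_integral_gau: "has_bochner_integral mu (gau :: 'a::euclidean_space \<Rightarrow> real) 1"
  using has_bochner_integral_gau_cos[of "0::'a"] by (simp add: gau_def[of 0])

text \<open>The product-to-sum formulas turn the two exponentials into trigonometric functions of
  \<open>y \<bullet> w\<close> and \<open>y' \<bullet> w\<close>, where \<open>y'\<close> is \<open>y\<close> with its second component negated, so that the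
  commutative Gaussian integral applies.\<close>
lemma has_bochner_integral_gau_twist:
  fixes y :: "'a::euclidean_space \<times> 'b::euclidean_space"
  shows "has_bochner_integral mu (\<lambda>w. gau w *\<^sub>R twist y w q) (gau y *\<^sub>R q)"
proof -
  define y' where "y' = (fst y, - snd y)"
  define A B C D where "A = (1/2) *\<^sub>R (q - qi * q * qj)" and "B = (1/2) *\<^sub>R (q + qi * q * qj)"
    and "C = (1/2) *\<^sub>R (qi * q + q * qj)" and "D = (1/2) *\<^sub>R (qi * q - q * qj)"
  have dec: "twist y w q = cos (y \<bullet> w) *\<^sub>R A + cos (y' \<bullet> w) *\<^sub>R B + sin (y \<bullet> w) *\<^sub>R C + sin (y' \<bullet> w) *\<^sub>R D" for w
    unfolding twist_def exp_qi exp_qj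
    by (simp add: A_def B_def C_def D_def y'_def inner_prod_def cos_add sin_add cos_diff sin_diff
        qi_def qj_def times_quat_def quat_eq_iff field_simps)
  have "has_bochner_integral mu (\<lambda>w. (gau w * cos (y \<bullet> w)) *\<^sub>R A + (gau w * cos (y' \<bullet> w)) *\<^sub>R B
      + (gau w * sin (y \<bullet> w)) *\<^sub>R C + (gau w * sin (y' \<bullet> w)) *\<^sub>R D)
      (gau y *\<^sub>R A + gau y' *\<^sub>R B + 0 *\<^sub>R C + 0 *\<^sub>R D)"
    by (intro has_bochner_integral_add has_bochner_integral_scaleR_left
        has_bochner_integral_gau_cos has_bochner_integral_gau_sin)
  \<comment> \<open>Flipping a sign preserves the norm, so both cosine terms carry the factor
    \<open>gau y\<close>, and \<open>A + B = q\<close> removes all dependence on the units.\<close>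
  moreover have "gau y' = gau y"
    by (simp add: gau_def y'_def norm_prod_def)
  moreover have "A + B = q"
    by (simp add: A_def B_def scaleR_add_right[symmetric] scaleR_2[symmetric])
  ultimately show ?thesis
    by (simp add: dec scaleR_add_right[symmetric]) (simp add: scaleR_add_right)
qed

text \<open>The dilation passes from \<open>w\<close> to \<open>y\<close> by
  \<open>twist_scaleR_commute\<close>: a wide Gaussian weight in frequency becomes a Gaussian in
  \<open>y\<close> of width \<open>\<epsilon>\<close> and total mass 1, an approximate
  identity.\<close>

lemma integral_gau_scaled_twist:
  fixes y :: "'a::euclidean_space \<times> 'b::euclidean_space"
  assumes "0 < \<epsilon>"
  shows "(LINT w|mu. gau (\<epsilon> *\<^sub>R w) *\<^sub>R twist y w q) = (gau ((1 / \<epsilon>) *\<^sub>R y) / \<epsilon> ^ DIM('a \<times> 'b)) *\<^sub>R q"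
proof -
  let ?F = "\<lambda>w. gau w *\<^sub>R twist ((1 / \<epsilon>) *\<^sub>R y) w q"
  have "gau ((1 / \<epsilon>) *\<^sub>R y) *\<^sub>R q = integral\<^sup>L mu ?F"
    by (rule has_bochner_integral_integral_eq[symmetric], rule has_bochner_integral_gau_twist)
  also have "\<dots> = \<bar>\<epsilon>\<bar> ^ DIM('a \<times> 'b) *\<^sub>R (LINT w|mu. ?F (0 + \<epsilon> *\<^sub>R w))"
    by (rule integral_mu_affine) (use assms in \<open>auto intro: borel_measurable_twist\<close>)
  also have "(LINT w|mu. ?F (0 + \<epsilon> *\<^sub>R w)) = (LINT w|mu. gau (\<epsilon> *\<^sub>R w) *\<^sub>R twist y w q)"
    using assms by (simp add: twist_scaleR_commute)
  finally show ?thesis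
    using assms by (simp add: divide_inverse mult.commute[of "gau _"] scaleR_scaleR[symmetric])
qed

lemma integrable_gau_scaled:
  assumes "0 < \<epsilon>"
  shows "integrable mu (\<lambda>w::'a::euclidean_space. gau (\<epsilon> *\<^sub>R w))"
  using integrable_mu_affine_iff[of gau \<epsilon> "0::'a"] assms has_bochner_integral_gau
  by (auto simp: has_bochner_integral_iff)

definition qft :: "('a::euclidean_space \<times> 'b::euclidean_space \<Rightarrow> quat) \<Rightarrow> 'a \<times> 'b \<Rightarrow> quat" where
  "qft h w = (LINT y|mu. twist (- y) w (h y))"

lemma borel_measurable_qft:
  assumes [measurable]: "h \<in> borel_measurable borel"
  shows "qft h \<in> borel_measurable borel"
proof -
  have "(\<lambda>w. LINT y|mu. twist (- y) w (h y)) \<in> borel_measurable borel"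
    by (rule mu.borel_measurable_lebesgue_integral) measurable
  then show ?thesis unfolding qft_def[abs_def] .
qed

lemma integrable_twist:
  assumes "integrable mu h" "f \<in> borel_measurable borel"
  shows "integrable mu (\<lambda>y. twist (f y) w (h y))"
  by (rule Bochner_Integration.integrable_bound[OF assms(1)])
     (use assms(2) borel_measurable_integrable[OF assms(1)] in \<open>auto intro!: borel_measurable_twist\<close>)

lemma norm_qft_le: "norm (qft h w) \<le> (LINT y|mu. norm (h y))"
  unfolding qft_def using integral_norm_bound[of mu "\<lambda>y. twist (- y) w (h y)"] by simp

section \<open>Plancherel theorem and inversion\<close>

text \<open>So far \<open>qft h\<close> is only known to be bounded, by the L1 norm of
  \<open>h\<close>; the Gaussian weight is what makes Fubini applicable. Expanding one factor of the
  square and moving its kernel to the other gives the pairing of \<open>h\<close> with its Gaussian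
  mean \<open>P\<close>, that is, a Gaussian average of the autocorrelation of
  \<open>h\<close>.\<close>

lemma plancherel_gau:
  fixes h :: "'a::euclidean_space \<times> 'b::euclidean_space \<Rightarrow> quat"
  assumes h: "integrable mu h" "square_integrable h" and \<epsilon>: "0 < \<epsilon>"
  shows "integrable mu (\<lambda>w. gau (\<epsilon> *\<^sub>R w) * (norm (qft h w))\<^sup>2)" (is ?I)
    and "(LINT w|mu. gau (\<epsilon> *\<^sub>R w) * (norm (qft h w))\<^sup>2)
      = (LINT z|mu. gau z * (LINT y|mu. h y \<bullet> h (y - \<epsilon> *\<^sub>R z)))" (is ?E)
proof -
  note [measurable] = square_integrableD(1)[OF h(2)] borel_measurable_qft[OF square_integrableD(1)[OF h(2)]]
  note gi = integrable_gau_scaled[OF \<epsilon>]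
  define G where "G = qft h"
  have [measurable]: "G \<in> borel_measurable borel" unfolding G_def by measurable
  define M where "M = (LINT y|mu. norm (h y))"
  have GM: "norm (G w) \<le> M" for w
    unfolding G_def M_def by (rule norm_qft_le)
  have "0 \<le> M" using GM[of 0] norm_ge_zero order_trans by blast
  have hn: "integrable mu (\<lambda>y. norm (h y))" using h by simp
  show ?I
  proof (rule Bochner_Integration.integrable_bound)
    show "integrable mu (\<lambda>w::'a\<times>'b. gau (\<epsilon> *\<^sub>R w) * M\<^sup>2)"
      by (rule integrable_mult_left) (rule gi)
    show "AE w in mu. norm (gau (\<epsilon> *\<^sub>R w) * (norm (qft h w))\<^sup>2) \<le> norm (gau (\<epsilon> *\<^sub>R w) * M\<^sup>2)"
      using GM by (auto simp: abs_mult G_def intro!: AE_I2 mult_left_mono power_mono)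
  qed measurable
  define P where "P y = (LINT w|mu. gau (\<epsilon> *\<^sub>R w) *\<^sub>R twist y w (G w))" for y
  have A: "(LINT w|mu. gau (\<epsilon> *\<^sub>R w) * (norm (G w))\<^sup>2) = (LINT y|mu. h y \<bullet> P y)"
  proof -
    let ?f = "\<lambda>w y. h y \<bullet> (gau (\<epsilon> *\<^sub>R w) *\<^sub>R twist y w (G w))"
    have "gau (\<epsilon> *\<^sub>R w) * (norm (G w))\<^sup>2 = (LINT y|mu. ?f w y)" for w
    proof -
      have "(norm (G w))\<^sup>2 = (LINT y|mu. twist (- y) w (h y)) \<bullet> G w"
        by (simp add: power2_norm_eq_inner G_def qft_def)
      also have "\<dots> = (LINT y|mu. twist (- y) w (h y) \<bullet> G w)"
        using h(1) by (intro integral_inner_left[symmetric] integrable_twist) auto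
      finally show ?thesis
        by (simp add: inner_twist)
    qed
    then have "(LINT w|mu. gau (\<epsilon> *\<^sub>R w) * (norm (G w))\<^sup>2) = (LINT w|mu. LINT y|mu. ?f w y)"
      by presburger
    also have "\<dots> = (LINT y|mu. LINT w|mu. ?f w y)"
    proof (rule mu2.Fubini_integral[symmetric], rule Bochner_Integration.integrable_bound)
      show "integrable (mu \<Otimes>\<^sub>M mu) (\<lambda>(w::'a\<times>'b, y). (gau (\<epsilon> *\<^sub>R w) * M) * norm (h y))"
        by (rule mu2.integrable_mult_pair) (use gi hn in auto)
      have "\<bar>h y \<bullet> (gau (\<epsilon> *\<^sub>R w) *\<^sub>R twist y w (G w))\<bar> \<le> gau (\<epsilon> *\<^sub>R w) * M * norm (h y)" for w y
      proof -
        have "\<bar>h y \<bullet> (gau (\<epsilon> *\<^sub>R w) *\<^sub>R twist y w (G w))\<bar> \<le> norm (h y) * norm (gau (\<epsilon> *\<^sub>R w) *\<^sub>R twist y w (G w))"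
          by (rule Cauchy_Schwarz_ineq2)
        also have "\<dots> \<le> norm (h y) * (gau (\<epsilon> *\<^sub>R w) * M)"
          using GM[of w] by (auto intro!: mult_left_mono)
        finally show ?thesis by (simp add: mult_ac)
      qed
      then show "AE p in mu \<Otimes>\<^sub>M mu. norm (case p of (w, y) \<Rightarrow> ?f w y) \<le> norm (case p of (w, y) \<Rightarrow> gau (\<epsilon> *\<^sub>R w) * M * norm (h y))"
        using \<open>0 \<le> M\<close> by (auto intro!: AE_I2)
    qed measurable
    also have "\<dots> = (LINT y|mu. h y \<bullet> P y)"
    proof (rule Bochner_Integration.integral_cong[OF refl])
      fix y
      have "integrable mu (\<lambda>w. gau (\<epsilon> *\<^sub>R w) *\<^sub>R twist y w (G w))"
      proof (rule Bochner_Integration.integrable_bound)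
        show "integrable mu (\<lambda>w::'a\<times>'b. gau (\<epsilon> *\<^sub>R w) * M)"
          by (rule integrable_mult_left) (rule gi)
        show "AE w in mu. norm (gau (\<epsilon> *\<^sub>R w) *\<^sub>R twist y w (G w)) \<le> norm (gau (\<epsilon> *\<^sub>R w) * M)"
          using GM \<open>0 \<le> M\<close> by (auto simp: abs_mult intro!: AE_I2 mult_left_mono)
      qed measurable
      then show "(LINT w|mu. ?f w y) = h y \<bullet> P y"
        unfolding P_def by (intro integral_inner_right) auto
    qed
    finally show ?thesis .
  qed
  \<comment> \<open>By the group law \<open>P\<close> has the kernel
    \<open>twist (y - y') w\<close>, whose weighted integral over \<open>w\<close> is the
    approximate identity; the Jacobian of y' = y - \<epsilon> z cancels its normalisation.\<close>
  have B: "P y = (LINT z|mu. gau z *\<^sub>R h (y - \<epsilon> *\<^sub>R z))" for y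
  proof -
    let ?f = "\<lambda>w y'. gau (\<epsilon> *\<^sub>R w) *\<^sub>R twist (y - y') w (h y')"
    let ?k = "\<lambda>y'. (gau ((1 / \<epsilon>) *\<^sub>R (y - y')) / \<epsilon> ^ DIM('a \<times> 'b)) *\<^sub>R h y'"
    have "twist y w (G w) = (LINT y'|mu. twist (y - y') w (h y'))" for w
    proof -
      have "twist y w (G w) = (LINT y'|mu. twist y w (twist (- y') w (h y')))"
        unfolding G_def qft_def
        by (rule integral_bounded_linear[OF bounded_linear_twist, symmetric], rule integrable_twist) (use h in auto)
      then show ?thesis by (simp add: twist_twist)
    qed
    then have "P y = (LINT w|mu. LINT y'|mu. ?f w y')"
      unfolding P_def by simp
    also have "\<dots> = (LINT y'|mu. LINT w|mu. ?f w y')"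
    proof (rule mu2.Fubini_integral[symmetric], rule Bochner_Integration.integrable_bound)
      show "integrable (mu \<Otimes>\<^sub>M mu) (\<lambda>(w::'a\<times>'b, y). gau (\<epsilon> *\<^sub>R w) * norm (h y))"
        by (rule mu2.integrable_mult_pair) (use gi hn in auto)
    qed auto
    also have "\<dots> = integral\<^sup>L mu ?k"
      by (simp add: integral_gau_scaled_twist[OF \<epsilon>])
    also have "\<dots> = \<bar>- \<epsilon>\<bar> ^ DIM('a \<times> 'b) *\<^sub>R (LINT z|mu. ?k (y + (- \<epsilon>) *\<^sub>R z))"
      by (rule integral_mu_affine) (use \<epsilon> in auto)
    also have "\<dots> = (LINT z|mu. \<bar>- \<epsilon>\<bar> ^ DIM('a \<times> 'b) *\<^sub>R ?k (y + (- \<epsilon>) *\<^sub>R z))"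
      by (rule integral_scaleR_right[symmetric])
    also have "(\<lambda>z. \<bar>- \<epsilon>\<bar> ^ DIM('a \<times> 'b) *\<^sub>R ?k (y + (- \<epsilon>) *\<^sub>R z)) = (\<lambda>z. gau z *\<^sub>R h (y - \<epsilon> *\<^sub>R z))"
      using \<epsilon> by (auto simp: fun_eq_iff)
    finally show ?thesis .
  qed
  have hsq: "integrable mu (\<lambda>y. (norm (h y))\<^sup>2)"
    by (rule square_integrableD(2)[OF h(2)])
  \<comment> \<open>The inner product is dominated by two squares; the shifted one is integrated
    over \<open>y\<close> first, where the shift disappears.\<close>
  have C: "(LINT y|mu. LINT z|mu. gau z * (h y \<bullet> h (y - \<epsilon> *\<^sub>R z)))
      = (LINT z|mu. LINT y|mu. gau z * (h y \<bullet> h (y - \<epsilon> *\<^sub>R z)))"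
  proof (rule mu2.Fubini_integral, rule Bochner_Integration.integrable_bound)
    have t: "integrable mu (\<lambda>y. (norm (h (y - a)))\<^sup>2)" "(LINT y|mu. (norm (h (y - a)))\<^sup>2) = (LINT y|mu. (norm (h y))\<^sup>2)" for a
      using hsq integrable_mu_translate[of "\<lambda>y. (norm (h y))\<^sup>2" a] integral_mu_translate[of "\<lambda>y. (norm (h y))\<^sup>2" a] by auto
    have g: "integrable mu (gau :: 'a \<times> 'b \<Rightarrow> real)"
      using has_bochner_integral_gau by (auto simp: has_bochner_integral_iff)
    have "integrable (mu \<Otimes>\<^sub>M mu) (\<lambda>(z::'a\<times>'b, y). gau z * (norm (h y))\<^sup>2)"
      by (rule mu2.integrable_mult_pair[OF g hsq])
    moreover have "integrable (mu \<Otimes>\<^sub>M mu) (\<lambda>(z, y). gau z * (norm (h (y - \<epsilon> *\<^sub>R z)))\<^sup>2)"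
      by (rule mu2.Fubini_integrable) (use g t in \<open>auto simp: abs_mult\<close>)
    ultimately show "integrable (mu \<Otimes>\<^sub>M mu) (\<lambda>p. (case p of (z::'a\<times>'b, y) \<Rightarrow> gau z * (norm (h y))\<^sup>2)
        + (case p of (z, y) \<Rightarrow> gau z * (norm (h (y - \<epsilon> *\<^sub>R z)))\<^sup>2))"
      by (rule Bochner_Integration.integrable_add)
    have "\<bar>gau z * (h y \<bullet> h (y - \<epsilon> *\<^sub>R z))\<bar> \<le> gau z * (norm (h y))\<^sup>2 + gau z * (norm (h (y - \<epsilon> *\<^sub>R z)))\<^sup>2" for z y
      using mult_left_mono[OF abs_inner_le_norm_squares, of "gau z"] by (simp add: abs_mult distrib_left)
    then show "AE p in mu \<Otimes>\<^sub>M mu. norm (case p of (z, y) \<Rightarrow> gau z * (h y \<bullet> h (y - \<epsilon> *\<^sub>R z)))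
      \<le> norm ((case p of (z::'a\<times>'b, y) \<Rightarrow> gau z * (norm (h y))\<^sup>2) + (case p of (z, y) \<Rightarrow> gau z * (norm (h (y - \<epsilon> *\<^sub>R z)))\<^sup>2))"
      by (auto intro!: AE_I2)
  qed measurable
  have "(LINT w|mu. gau (\<epsilon> *\<^sub>R w) * (norm (G w))\<^sup>2) = (LINT y|mu. LINT z|mu. gau z * (h y \<bullet> h (y - \<epsilon> *\<^sub>R z)))"
    unfolding A
  proof (rule Bochner_Integration.integral_cong[OF refl])
    fix y
    have "integrable mu (\<lambda>z. gau z *\<^sub>R h (y - \<epsilon> *\<^sub>R z))"
    proof (rule Bochner_Integration.integrable_bound)
      show "integrable mu (\<lambda>z. h (y - \<epsilon> *\<^sub>R z))"
        using integrable_mu_affine_iff[of h "-\<epsilon>" y] \<epsilon> h(1) by auto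
      show "AE z in mu. norm (gau z *\<^sub>R h (y - \<epsilon> *\<^sub>R z)) \<le> norm (h (y - \<epsilon> *\<^sub>R z))"
        by (auto intro!: AE_I2 mult_left_le_one_le gau_le_1)
    qed measurable
    then show "h y \<bullet> P y = (LINT z|mu. gau z * (h y \<bullet> h (y - \<epsilon> *\<^sub>R z)))"
      unfolding B by (subst integral_inner_right[symmetric]) auto
  qed
  then show ?E
    unfolding C by (simp add: G_def)
qed

text \<open>Polarisation and translation invariance. The autocorrelation is expressed through the L2
  distance to the translate, from which its bound and its limit at 0 are read off.\<close>

lemma integral_inner_translate:
  fixes h :: "'a::euclidean_space \<Rightarrow> 'b::euclidean_space"
  assumes "square_integrable h"
  shows "(LINT y|mu. h y \<bullet> h (y - a))
    = (LINT y|mu. (norm (h y))\<^sup>2) - (LINT y|mu. (norm (h y - h (y - a)))\<^sup>2) / 2"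
proof -
  note [measurable] = square_integrableD(1)[OF assms]
  note i = square_integrableD(2)[OF assms] square_integrableD(2)[OF square_integrable_translate[OF assms, of a]]
    square_integrableD(2)[OF square_integrable_diff[OF assms square_integrable_translate[OF assms, of a]]]
  have "(LINT y|mu. h y \<bullet> h (y - a)) = (LINT y|mu. ((norm (h y))\<^sup>2 + (norm (h (y - a)))\<^sup>2 - (norm (h y - h (y - a)))\<^sup>2) / 2)"
    by (intro Bochner_Integration.integral_cong) (auto simp: power2_norm_eq_inner inner_diff inner_commute)
  also have "\<dots> = ((LINT y|mu. (norm (h y))\<^sup>2) + (LINT y|mu. (norm (h (y - a)))\<^sup>2) - (LINT y|mu. (norm (h y - h (y - a)))\<^sup>2)) / 2"
    using i by simp
  also have "(LINT y|mu. (norm (h (y - a)))\<^sup>2) = (LINT y|mu. (norm (h y))\<^sup>2)"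
    by (rule integral_mu_translate) measurable
  finally show ?thesis by (simp add: field_simps)
qed

text \<open>Let \<open>\<epsilon>\<close> tend to 0 in \<open>plancherel_gau\<close>. The right side
  converges by dominated convergence; on the left the weights increase to 1, so monotone convergence
  yields the integrability of the square and its value at once.\<close>

lemma
  fixes h :: "'a::euclidean_space \<times> 'b::euclidean_space \<Rightarrow> quat"
  assumes h: "integrable mu h" "square_integrable h"
  shows square_integrable_qft: "square_integrable (qft h)" 
    and plancherel_qft: "(LINT w|mu. (norm (qft h w))\<^sup>2) = (LINT y|mu. (norm (h y))\<^sup>2)"
proof -
  note [measurable] = square_integrableD(1)[OF h(2)] borel_measurable_qft[OF square_integrableD(1)[OF h(2)]]
  define \<epsilon> where "\<epsilon> n = inverse (real (Suc n))" for n
  have \<epsilon>0: "0 < \<epsilon> n" for n by (simp add: \<epsilon>_def)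
  have \<epsilon>lim: "\<epsilon> \<longlonglongrightarrow> 0" unfolding \<epsilon>_def by (rule LIMSEQ_inverse_real_of_nat)
  define N where "N = (LINT y|mu. (norm (h y))\<^sup>2)"
  define A where "A v = (LINT y|mu. h y \<bullet> h (y - v))" for v
  define D where "D v = (LINT y|mu. (norm (h y - h (y - v)))\<^sup>2)" for v
  have A: "A v = N - D v / 2" for v
    unfolding A_def N_def D_def by (rule integral_inner_translate[OF h(2)])
  \<comment> \<open>These bounds put \<open>A v = N - D v / 2\<close> between \<open>- N\<close> and
    \<open>N\<close>, which makes \<open>gau z * N\<close> a majorant.\<close>
  have D: "0 \<le> D v" "D v \<le> 4 * N" for v
  proof -
    show "0 \<le> D v" unfolding D_def by (rule integral_nonneg_AE) auto
    have i: "integrable mu (\<lambda>y. (norm (h (y - v)))\<^sup>2)" "integrable mu (\<lambda>y. (norm (h y))\<^sup>2)"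
      using h by (auto intro!: square_integrableD square_integrable_translate)
    have "D v \<le> (LINT y|mu. 2 * (norm (h y))\<^sup>2 + 2 * (norm (h (y - v)))\<^sup>2)"
      unfolding D_def using i h
      by (intro integral_mono norm_sq_diff_le square_integrableD square_integrable_diff square_integrable_translate
          Bochner_Integration.integrable_add integrable_mult_right)
    also have "\<dots> = 2 * N + 2 * (LINT y|mu. (norm (h (y - v)))\<^sup>2)"
      using i by (simp add: N_def)
    also have "(LINT y|mu. (norm (h (y - v)))\<^sup>2) = N"
      unfolding N_def by (rule integral_mu_translate) measurable
    finally show "D v \<le> 4 * N" by simp
  qed
  have g: "integrable mu (gau :: 'a \<times> 'b \<Rightarrow> real)" "integral\<^sup>L mu (gau :: 'a \<times> 'b \<Rightarrow> real) = 1"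
    using has_bochner_integral_gau[where 'a="'a\<times>'b"] by (auto simp: has_bochner_integral_iff)
  have Dm: "D \<in> borel_measurable borel"
  proof -
    have "(\<lambda>v. LINT y|mu. (norm (h y - h (y - v)))\<^sup>2) \<in> borel_measurable borel"
      by (rule mu.borel_measurable_lebesgue_integral) measurable
    then show ?thesis unfolding D_def[abs_def] .
  qed
  have Am[measurable]: "A \<in> borel_measurable borel"
    unfolding A[abs_def] using Dm by measurable
  have "(\<lambda>n. LINT z::'a\<times>'b|mu. gau z * A (\<epsilon> n *\<^sub>R z)) \<longlonglongrightarrow> (LINT z::'a\<times>'b|mu. gau z * N)"
  proof (rule integral_dominated_convergence[where w="\<lambda>z. gau z * N"])
    show "AE z in mu. (\<lambda>n. gau z * A (\<epsilon> n *\<^sub>R z)) \<longlonglongrightarrow> gau z * N"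
    proof (rule AE_I2)
      fix z :: "'a \<times> 'b"
      have "(\<lambda>n. \<epsilon> n *\<^sub>R z) \<longlonglongrightarrow> 0"
        using \<epsilon>lim by (auto intro!: tendsto_eq_intros)
      then have "(\<lambda>n. D (\<epsilon> n *\<^sub>R z)) \<longlonglongrightarrow> 0"
        unfolding D_def by (rule L2_translation_continuous[OF h(2)])
      then show "(\<lambda>n. gau z * A (\<epsilon> n *\<^sub>R z)) \<longlonglongrightarrow> gau z * N"
        unfolding A by (auto intro!: tendsto_eq_intros)
    qed
    show "AE z in mu. norm (gau z * A (\<epsilon> n *\<^sub>R z)) \<le> gau z * N" for n
    proof (rule AE_I2)
      fix z :: "'a \<times> 'b"
      have "\<bar>A (\<epsilon> n *\<^sub>R z)\<bar> \<le> N"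
        using D[of "\<epsilon> n *\<^sub>R z"] unfolding A by linarith
      then show "norm (gau z * A (\<epsilon> n *\<^sub>R z)) \<le> gau z * N"
        by (simp add: abs_mult)
    qed
  qed (use g in auto)
  then have lim: "(\<lambda>n. LINT w|mu. gau (\<epsilon> n *\<^sub>R w) * (norm (qft h w))\<^sup>2) \<longlonglongrightarrow> N"
    unfolding plancherel_gau(2)[OF h \<epsilon>0] A_def using g by simp
  have mono: "gau (\<epsilon> m *\<^sub>R w) \<le> gau (\<epsilon> n *\<^sub>R w)" if "m \<le> n" for m n and w :: "'a\<times>'b"
  proof -
    have "\<epsilon> n \<le> \<epsilon> m" using that by (simp add: \<epsilon>_def field_simps)
    then have "norm (\<epsilon> n *\<^sub>R w) \<le> norm (\<epsilon> m *\<^sub>R w)"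
      using \<epsilon>0[of n] \<epsilon>0[of m] by (auto intro!: mult_right_mono)
    then show ?thesis
      by (simp add: gau_def power_mono)
  qed
  have "has_bochner_integral mu (\<lambda>w. (norm (qft h w))\<^sup>2) N"
  proof -
    have 1: "AE w in mu. mono (\<lambda>n. gau (\<epsilon> n *\<^sub>R w) * (norm (qft h w))\<^sup>2)"
      by (intro AE_I2 monoI mult_right_mono mono) auto
    have 2: "AE w in mu. (\<lambda>n. gau (\<epsilon> n *\<^sub>R w) * (norm (qft h w))\<^sup>2) \<longlonglongrightarrow> (norm (qft h w))\<^sup>2"
      unfolding gau_def using \<epsilon>lim by (auto intro!: AE_I2 tendsto_eq_intros)
    have 3: "(\<lambda>w. (norm (qft h w))\<^sup>2) \<in> borel_measurable mu" by measurable
    show ?thesis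
      using integrable_monotone_convergence[OF plancherel_gau(1)[OF h \<epsilon>0] 1 2 lim 3]
        integral_monotone_convergence[OF plancherel_gau(1)[OF h \<epsilon>0] 1 2 lim 3]
      by (simp add: has_bochner_integral_iff)
  qed
  then show "(LINT w|mu. (norm (qft h w))\<^sup>2) = (LINT y|mu. (norm (h y))\<^sup>2)" "square_integrable (qft h)"
    by (auto simp: has_bochner_integral_iff N_def intro!: square_integrableI)
qed

section \<open>Parseval, adjointness and inversion\<close>

lemma inner_eq_norm_polar:
  "a \<bullet> b = ((norm (a + b))\<^sup>2 - (norm a)\<^sup>2 - (norm b)\<^sup>2) / 2" for a b :: "'a::real_inner"
  by (simp add: power2_norm_eq_inner inner_add inner_commute)

lemma integral_inner_polar:
  fixes f g :: "'a \<Rightarrow> 'b::euclidean_space"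
  assumes "integrable M (\<lambda>x. (norm (f x))\<^sup>2)" "integrable M (\<lambda>x. (norm (g x))\<^sup>2)" "integrable M (\<lambda>x. (norm (f x + g x))\<^sup>2)"
  shows "(LINT x|M. f x \<bullet> g x) = ((LINT x|M. (norm (f x + g x))\<^sup>2) - (LINT x|M. (norm (f x))\<^sup>2) - (LINT x|M. (norm (g x))\<^sup>2)) / 2"
  using assms by (simp add: inner_eq_norm_polar)

lemma qft_add:
  assumes "integrable mu f" "integrable mu g"
  shows "qft (\<lambda>y. f y + g y) w = qft f w + qft g w"
  unfolding qft_def twist_add
  by (rule Bochner_Integration.integral_add) (use assms in \<open>auto intro!: integrable_twist\<close>)

text \<open>Polarisation of Plancherel; since the inner product is real-valued, the sum of
  \<open>f\<close> and \<open>g\<close> alone suffices.\<close>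

lemma parseval_qft:
  fixes f g :: "'a::euclidean_space \<times> 'b::euclidean_space \<Rightarrow> quat"
  assumes f: "integrable mu f" "square_integrable f" and g: "integrable mu g" "square_integrable g"
  shows "(LINT w|mu. qft f w \<bullet> qft g w) = (LINT y|mu. f y \<bullet> g y)"
proof -
  have fg: "integrable mu (\<lambda>y. f y + g y)" "square_integrable (\<lambda>y. f y + g y)"
    using f g by (auto intro!: square_integrable_add)
  note s = square_integrable_qft[OF f] square_integrable_qft[OF g] square_integrable_qft[OF fg]
  have "(\<lambda>w. qft (\<lambda>y. f y + g y) w) = (\<lambda>w. qft f w + qft g w)"
    using qft_add[OF f(1) g(1)] by auto
  then show ?thesis
    using s(1,2)[THEN square_integrableD(2)] s(3)[THEN square_integrableD(2)]
      f(2) g(2) fg(2)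
      plancherel_qft[OF f] plancherel_qft[OF g] plancherel_qft[OF fg]
    by (subst (1 2) integral_inner_polar) (auto dest: square_integrableD)
qed

text \<open>Fubini and \<open>inner_twist\<close>: the kernel is isometric, so
  \<open>norm (k w) * norm (q y)\<close> is a majorant. On integrable functions the inverse
  transform is thus the adjoint of \<open>qft\<close>.\<close>

lemma integral_inner_qft:
  fixes k q :: "'a::euclidean_space \<times> 'b::euclidean_space \<Rightarrow> quat"
  assumes k: "integrable mu k" and q: "integrable mu q"
  shows "(LINT y|mu. (LINT w|mu. twist y w (k w)) \<bullet> q y) = (LINT w|mu. k w \<bullet> qft q w)"
proof -
  have [measurable]: "k \<in> borel_measurable borel" "q \<in> borel_measurable borel"
    using k q by (auto dest!: borel_measurable_integrable simp: measurable_cong_sets[OF sets_mu refl])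
  have "(LINT y|mu. (LINT w|mu. twist y w (k w)) \<bullet> q y) = (LINT y|mu. LINT w|mu. k w \<bullet> twist (- y) w (q y))"
  proof (rule Bochner_Integration.integral_cong[OF refl])
    fix y
    have "integrable mu (\<lambda>w. twist y w (k w))"
      by (rule Bochner_Integration.integrable_bound[OF k]) auto
    then have "(LINT w|mu. twist y w (k w)) \<bullet> q y = (LINT w|mu. twist y w (k w) \<bullet> q y)"
      by (intro integral_inner_left[symmetric]) auto
    then show "(LINT w|mu. twist y w (k w)) \<bullet> q y = (LINT w|mu. k w \<bullet> twist (- y) w (q y))"
      by (simp add: inner_twist)
  qed
  also have "\<dots> = (LINT w|mu. LINT y|mu. k w \<bullet> twist (- y) w (q y))"
  proof (rule mu2.Fubini_integral, rule Bochner_Integration.integrable_bound)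
    show "integrable (mu \<Otimes>\<^sub>M mu) (\<lambda>(w, y). norm (k w) * norm (q y))"
      using k q by (intro mu2.integrable_mult_pair) auto
    have "\<bar>k w \<bullet> twist (- y) w (q y)\<bar> \<le> norm (k w) * norm (q y)" for w y
      using Cauchy_Schwarz_ineq2[of "k w" "twist (- y) w (q y)"] by simp
    then show "AE p in mu \<Otimes>\<^sub>M mu. norm (case p of (w, y) \<Rightarrow> k w \<bullet> twist (- y) w (q y)) \<le> norm (case p of (w, y) \<Rightarrow> norm (k w) * norm (q y))"
      by (auto intro!: AE_I2)
  qed measurable
  also have "\<dots> = (LINT w|mu. k w \<bullet> qft q w)"
    unfolding qft_def
    by (intro Bochner_Integration.integral_cong refl integral_inner_right integrable_twist q) auto
  finally show ?thesis .
qed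

text \<open>\<open>r\<close> need not be square-integrable, but its pairing with its own truncation
  is the squared norm of that truncation. So all truncations vanish almost everywhere, and they
  converge to \<open>r\<close>.\<close>

lemma AE_zero_of_orthogonal:
  fixes r :: "'a::euclidean_space \<Rightarrow> 'b::euclidean_space"
  assumes "r \<in> borel_measurable borel"
    and "\<And>n. (LINT y|mu. r y \<bullet> truncate_to_ball (real n) r y) = 0"
  shows "AE y in mu. r y = 0"
proof -
  have "AE y in mu. truncate_to_ball (real n) r y = 0" for n
  proof -
    have "(LINT y|mu. (norm (truncate_to_ball (real n) r y))\<^sup>2) = (LINT y|mu. r y \<bullet> truncate_to_ball (real n) r y)"
      by (intro Bochner_Integration.integral_cong) (auto simp: truncate_to_ball_def power2_norm_eq_inner)
    then have "AE y in mu. (norm (truncate_to_ball (real n) r y))\<^sup>2 = 0"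
      using assms square_integrableD(2)[OF square_integrable_truncate_to_ball[OF assms(1), of "real n"]]
      by (subst integral_nonneg_eq_0_iff_AE[symmetric]) auto
    then show ?thesis by simp
  qed
  then have "AE y in mu. \<forall>n. truncate_to_ball (real n) r y = 0"
    by (simp add: AE_all_countable)
  then show ?thesis
  proof eventually_elim
    case (elim y)
    then show ?case
      using truncate_to_ball_tendsto[of r y] by (simp add: LIMSEQ_const_iff)
  qed
qed

text \<open>A weak argument: by \<open>integral_inner_qft\<close> and \<open>parseval_qft\<close>,
  the inverse transform \<open>H\<close> and \<open>h\<close> have the same pairing with every
  integrable and square-integrable test function, in particular with the truncations of
  \<open>H - h\<close>.\<close>

lemma qft_inversion:
  fixes h :: "'a::euclidean_space \<times> 'b::euclidean_space \<Rightarrow> quat"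
  assumes h: "integrable mu h" "square_integrable h" and hh: "integrable mu (qft h)"
  shows "AE y in mu. (LINT w|mu. twist y w (qft h w)) = h y"
proof -
  note [measurable] = square_integrableD(1)[OF h(2)] borel_measurable_qft[OF square_integrableD(1)[OF h(2)]]
  define H where "H y = (LINT w|mu. twist y w (qft h w))" for y
  have Hm: "H \<in> borel_measurable borel"
  proof -
    have "(\<lambda>y. LINT w|mu. twist y w (qft h w)) \<in> borel_measurable borel"
      by (rule mu.borel_measurable_lebesgue_integral) measurable
    then show ?thesis unfolding H_def[abs_def] .
  qed
  \<comment> \<open>Boundedness of \<open>H\<close> makes its pairing with an integrable
    \<open>q\<close> integrable, so that the two pairings may be subtracted.\<close>
  have HB: "norm (H y) \<le> (LINT w|mu. norm (qft h w))" for y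
    unfolding H_def using integral_norm_bound[of mu "\<lambda>w. twist y w (qft h w)"] by simp
  define r where "r y = H y - h y" for y
  have rm: "r \<in> borel_measurable borel"
    unfolding r_def[abs_def] using Hm by measurable
  have "AE y in mu. r y = 0"
  proof (rule AE_zero_of_orthogonal[OF rm])
    fix n
    define q where "q = truncate_to_ball (real n) r"
    have qi: "integrable mu q" and qs: "square_integrable q" and qm[measurable]: "q \<in> borel_measurable borel"
      unfolding q_def using rm
      by (auto intro!: integrable_truncate_to_ball square_integrable_truncate_to_ball borel_measurable_truncate_to_ball)
    have "(LINT y|mu. H y \<bullet> q y) = (LINT y|mu. h y \<bullet> q y)"
      using integral_inner_qft[OF hh qi] parseval_qft[OF h qi qs] by (simp add: H_def)
    moreover have "integrable mu (\<lambda>y. h y \<bullet> q y)"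
      by (rule integrable_inner_square_integrable[OF h(2) qs])
    moreover have "integrable mu (\<lambda>y. H y \<bullet> q y)"
    proof (rule Bochner_Integration.integrable_bound)
      show "integrable mu (\<lambda>y. (LINT w|mu. norm (qft h w)) * norm (q y))"
        using qi by simp
      show "AE y in mu. norm (H y \<bullet> q y) \<le> norm ((LINT w|mu. norm (qft h w)) * norm (q y))"
        using HB by (auto simp: abs_mult intro!: AE_I2 order_trans[OF Cauchy_Schwarz_ineq2] mult_right_mono order_trans[OF _ abs_ge_self])
    qed (use Hm in measurable)
    ultimately show "(LINT y|mu. r y \<bullet> truncate_to_ball (real n) r y) = 0"
      unfolding q_def[symmetric] by (simp add: r_def inner_diff_left)
  qed
  then show ?thesis
    by (simp add: r_def H_def)
qed

section \<open>The windowed transform\<close>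

interpretation mu3: pair_sigma_finite
  "mu :: 'a::euclidean_space measure" "(mu :: 'b::euclidean_space measure) \<Otimes>\<^sub>M (mu :: 'c::euclidean_space measure)"
  by (intro pair_sigma_finite.intro mu.sigma_finite_measure_axioms mu2.P.sigma_finite_measure_axioms)

text \<open>A real window is self-conjugate and central, so it enters as a scalar on
  \<open>f\<close> before the two-sided transform; \<open>qwft_eq_stft\<close> identifies the result
  with \<open>qwft\<close>.\<close>

definition stft :: "('a::euclidean_space \<times> 'b::euclidean_space \<Rightarrow> real) \<Rightarrow> ('a \<times> 'b \<Rightarrow> quat)
    \<Rightarrow> ('a \<times> 'b) \<times> ('a \<times> 'b) \<Rightarrow> quat" where
  "stft g f p = qft (\<lambda>y. g (y - fst p) *\<^sub>R f y) (snd p)"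

context
  fixes g :: "'a::euclidean_space \<times> 'b::euclidean_space \<Rightarrow> real"
  assumes g: "square_integrable g"
begin

private lemma gm [measurable]: "g \<in> borel_measurable borel"
  using g by (rule square_integrableD)

private lemma shift_sq:
  "integrable mu (\<lambda>t. (g (t - a))\<^sup>2)" "(LINT t|mu. (g (t - a))\<^sup>2) = (LINT y|mu. (g y)\<^sup>2)"
  "integrable mu (\<lambda>x. (g (a - x))\<^sup>2)" "(LINT x|mu. (g (a - x))\<^sup>2) = (LINT y|mu. (g y)\<^sup>2)"
  using square_integrableD(2)[OF g]
    integrable_mu_translate[of "\<lambda>y. (g y)\<^sup>2" a] integral_mu_translate[of "\<lambda>y. (g y)\<^sup>2" a]
    integrable_mu_reflect[of "\<lambda>y. (g y)\<^sup>2" a] integral_mu_reflect[of "\<lambda>y. (g y)\<^sup>2" a]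
  by simp_all

lemma integrable_windowed:
  assumes "square_integrable f"
  shows "integrable mu (\<lambda>y. g (y - x) *\<^sub>R (f y :: quat))"
proof (rule Bochner_Integration.integrable_bound)
  note [measurable] = square_integrableD(1)[OF assms]
  show "integrable mu (\<lambda>y. (g (y - x))\<^sup>2 + (norm (f y))\<^sup>2)"
    using shift_sq square_integrableD(2)[OF assms] by simp
  show "AE y in mu. norm (g (y - x) *\<^sub>R f y) \<le> norm ((g (y - x))\<^sup>2 + (norm (f y))\<^sup>2)"
    using abs_mult_le_sum_squares[of "g (_ - x)" "norm (f _)"] by auto
qed (use square_integrableD(1)[OF assms] in measurable)

lemma borel_measurable_stft [measurable]:
  assumes [measurable]: "f \<in> borel_measurable borel"
  shows "stft g f \<in> borel_measurable (mu \<Otimes>\<^sub>M mu)"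
proof -
  have "(\<lambda>p. LINT y|mu. twist (- y) (snd p) (g (y - fst p) *\<^sub>R f y)) \<in> borel_measurable (mu \<Otimes>\<^sub>M mu)"
    by (rule mu.borel_measurable_lebesgue_integral) measurable
  then show ?thesis
    unfolding stft_def[abs_def] qft_def .
qed

text \<open>A crude bound, but uniform in \<open>p\<close>, which gives integrability over compact
  sets.\<close>

lemma norm_stft_le:
  assumes "square_integrable f"
  shows "norm (stft g f p) \<le> (LINT y|mu. (g y)\<^sup>2) + (LINT y|mu. (norm (f y))\<^sup>2)"
proof -
  have "norm (stft g f p) \<le> (LINT y|mu. norm (g (y - fst p) *\<^sub>R f y))"
    unfolding stft_def by (rule norm_qft_le)
  also have "\<dots> \<le> (LINT y|mu. (g (y - fst p))\<^sup>2 + (norm (f y))\<^sup>2)"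
  proof (rule integral_mono)
    show "norm (g (y - fst p) *\<^sub>R f y) \<le> (g (y - fst p))\<^sup>2 + (norm (f y))\<^sup>2" for y
      using abs_mult_le_sum_squares[of "g (y - fst p)" "norm (f y)"] by simp
  qed (use integrable_norm[OF integrable_windowed[OF assms, of "fst p"]] shift_sq[of "fst p"] square_integrableD(2)[OF assms] in auto)
  also have "\<dots> = (LINT y|mu. (g y)\<^sup>2) + (LINT y|mu. (norm (f y))\<^sup>2)"
    using shift_sq square_integrableD(2)[OF assms] by simp
  finally show ?thesis .
qed

lemma stft_add:
  assumes "square_integrable f" "square_integrable h"
  shows "stft g (\<lambda>y. f y + h y) p = stft g f p + stft g h p"
  unfolding stft_def scaleR_add_right
  using qft_add[OF integrable_windowed[OF assms(1)] integrable_windowed[OF assms(2)]] .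

text \<open>For fixed \<open>y\<close> the integral of the squared window over \<open>x\<close> does
  not depend on \<open>y\<close>, so integrating over \<open>x\<close> first leaves only the norm of
  \<open>f\<close>. Hence the proof starts with the variables in swapped order.\<close>

lemma has_bochner_integral_windowed:
  assumes f: "square_integrable (f :: 'a \<times> 'b \<Rightarrow> quat)"
  shows "has_bochner_integral (mu \<Otimes>\<^sub>M mu) (\<lambda>(x, y). (norm (g (y - x) *\<^sub>R f y))\<^sup>2)
    ((LINT y|mu. (g y)\<^sup>2) * (LINT y|mu. (norm (f y))\<^sup>2))"
proof -
  note [measurable] = square_integrableD(1)[OF f]
  have 1: "integrable (mu \<Otimes>\<^sub>M mu) (\<lambda>(y, x). (norm (g (y - x) *\<^sub>R f y))\<^sup>2)"
    by (rule mu2.Fubini_integrable)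
       (use shift_sq square_integrableD(2)[OF f] in \<open>auto simp: power_mult_distrib\<close>)
  have "(LINT p|(mu \<Otimes>\<^sub>M mu). (case p of (x, y) \<Rightarrow> (norm (g (y - x) *\<^sub>R f y))\<^sup>2))
     = (LINT p|(mu \<Otimes>\<^sub>M mu). (case p of (y, x) \<Rightarrow> (norm (g (y - x) *\<^sub>R f y))\<^sup>2))"
    by (subst mu2.integral_product_swap[symmetric]) (auto simp: case_prod_beta)
  also have "\<dots> = (LINT y|mu. LINT x|mu. (norm (g (y - x) *\<^sub>R f y))\<^sup>2)"
    using mu2.integral_fst'[OF 1] by simp
  also have "\<dots> = (LINT y|mu. (g y)\<^sup>2) * (LINT y|mu. (norm (f y))\<^sup>2)"
    using shift_sq by (simp add: power_mult_distrib)
  finally show ?thesis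
    using mu2.integrable_product_swap[OF 1] by (simp add: has_bochner_integral_iff case_prod_unfold)
qed

lemma AE_square_integrable_windowed:
  assumes f: "square_integrable (f :: 'a \<times> 'b \<Rightarrow> quat)"
  shows "AE x in mu. square_integrable (\<lambda>y. g (y - x) *\<^sub>R f y)"
proof -
  note [measurable] = square_integrableD(1)[OF f]
  have "AE x in mu. integrable mu (\<lambda>y. (norm (g (y - x) *\<^sub>R f y))\<^sup>2)"
    using mu2.AE_integrable_fst'[OF has_bochner_integral_windowed[OF f, THEN has_bochner_integral_iff[THEN iffD1], THEN conjunct1]]
    by simp
  then show ?thesis
    by eventually_elim (auto intro!: square_integrableI)
qed

text \<open>Plancherel applies for almost every \<open>x\<close>, namely where the windowed function
  is square-integrable; integrating over \<open>x\<close> reduces the claim to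
  \<open>has_bochner_integral_windowed\<close>.\<close>

lemma has_bochner_integral_norm_stft:
  assumes f: "square_integrable (f :: 'a \<times> 'b \<Rightarrow> quat)"
  shows "has_bochner_integral (mu \<Otimes>\<^sub>M mu) (\<lambda>p. (norm (stft g f p))\<^sup>2)
    ((LINT y|mu. (g y)\<^sup>2) * (LINT y|mu. (norm (f y))\<^sup>2))"
proof -
  note fm[measurable] = square_integrableD(1)[OF f]
  note [measurable] = borel_measurable_stft[OF fm]
  note w = has_bochner_integral_windowed[OF f, unfolded has_bochner_integral_iff]
  have eq: "AE x in mu. integrable mu (\<lambda>w. (norm (stft g f (x, w)))\<^sup>2) \<and>
      (LINT w|mu. (norm (stft g f (x, w)))\<^sup>2) = (LINT y|mu. (norm (g (y - x) *\<^sub>R f y))\<^sup>2)"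
    using AE_square_integrable_windowed[OF f]
  proof eventually_elim
    case (elim x)
    show ?case
      using plancherel_qft[OF integrable_windowed[OF f] elim]
        square_integrableD(2)[OF square_integrable_qft[OF integrable_windowed[OF f] elim]]
      by (simp add: stft_def)
  qed
  have i: "integrable mu (\<lambda>x. LINT y|mu. (norm (g (y - x) *\<^sub>R f y))\<^sup>2)"
    using mu2.integrable_fst'[OF w[THEN conjunct1]] by simp
  have I: "integrable (mu \<Otimes>\<^sub>M mu) (\<lambda>p. (norm (stft g f p))\<^sup>2)"
  proof (rule mu2.Fubini_integrable)
    show "integrable mu (\<lambda>x. LINT w|mu. norm ((norm (stft g f (x, w)))\<^sup>2))"
    proof (rule integrable_cong_AE_imp[OF i])
      show "AE x in mu. (LINT y|mu. (norm (g (y - x) *\<^sub>R f y))\<^sup>2) = (LINT w|mu. norm ((norm (stft g f (x, w)))\<^sup>2))"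
        using eq by eventually_elim simp
    qed measurable
    show "AE x in mu. integrable mu (\<lambda>w. (norm (stft g f (x, w)))\<^sup>2)"
      using eq by eventually_elim simp
  qed measurable
  have "(LINT p|(mu \<Otimes>\<^sub>M mu). (norm (stft g f p))\<^sup>2) = (LINT x|mu. LINT w|mu. (norm (stft g f (x, w)))\<^sup>2)"
    by (rule mu2.integral_fst'[OF I, symmetric])
  also have "\<dots> = (LINT x|mu. LINT y|mu. (norm (g (y - x) *\<^sub>R f y))\<^sup>2)"
    by (rule integral_cong_AE) (use eq in \<open>auto elim: eventually_mono\<close>)
  also have "\<dots> = (LINT y|mu. (g y)\<^sup>2) * (LINT y|mu. (norm (f y))\<^sup>2)"
    using mu2.integral_fst'[OF w[THEN conjunct1]] w by simp
  finally show ?thesis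
    using I by (simp add: has_bochner_integral_iff)
qed

lemma integral_inner_stft:
  fixes f h :: "'a \<times> 'b \<Rightarrow> quat"
  assumes f: "square_integrable f" and h: "square_integrable h"
  shows "(LINT p|(mu \<Otimes>\<^sub>M mu). stft g f p \<bullet> stft g h p) = (LINT y|mu. (g y)\<^sup>2) * (LINT y|mu. f y \<bullet> h y)"
proof -
  note fh = square_integrable_add[OF f h]
  note * = has_bochner_integral_norm_stft[unfolded has_bochner_integral_iff]
  show ?thesis
    using *[OF f] *[OF h] *[OF fh] square_integrableD(2)[OF f] square_integrableD(2)[OF h] square_integrableD(2)[OF fh]
    unfolding stft_add[OF f h]
    by (subst (1 2) integral_inner_polar) (auto simp: algebra_simps)
qed

lemma set_integrable_synthesis:
  fixes f :: "'a \<times> 'b \<Rightarrow> quat"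
  assumes f: "square_integrable f" and K: "compact K"
  shows "set_integrable (mu \<Otimes>\<^sub>M mu) K (\<lambda>p. g (t - fst p) *\<^sub>R twist t (snd p) (stft g f p))"
  unfolding set_integrable_def
proof (rule Bochner_Integration.integrable_bound)
  note fm[measurable] = square_integrableD(1)[OF f]
  have Km[measurable]: "K \<in> sets (mu \<Otimes>\<^sub>M mu)"
    unfolding sets_mu_pair using K by (rule borel_compact)
  define A B where "A = fst ` K" and "B = snd ` K"
  have c: "compact A" "compact B"
    using K by (auto simp: A_def B_def intro!: compact_continuous_image continuous_intros)
  then have ind: "integrable mu (indicator A :: 'a \<times> 'b \<Rightarrow> real)" "integrable mu (indicator B :: 'a \<times> 'b \<Rightarrow> real)"
    using emeasure_mu_bounded_finite[of A] emeasure_mu_bounded_finite[of B]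
    by (auto intro!: integrable_real_indicator simp: compact_imp_bounded borel_closed compact_imp_closed)
  define C where "C = (LINT y|mu. (g y)\<^sup>2) + (LINT y|mu. (norm (f y))\<^sup>2)"
  have C: "norm (stft g f p) \<le> C" for p
    unfolding C_def by (rule norm_stft_le[OF f])
  have "0 \<le> C" using C[of 0] norm_ge_zero order_trans by blast
  \<comment> \<open>On \<open>K\<close> the inequality |g| \<le> 1 + g^2 gives the bound (1 + g^2)
    C. Indicators of the projections \<open>A\<close> and \<open>B\<close> turn it into a product of
    functions of \<open>x\<close> and of \<open>w\<close>, integrable for every
    \<open>t\<close>.\<close>
  show "integrable (mu \<Otimes>\<^sub>M mu) (\<lambda>(x, w). (indicator A x + (g (t - x))\<^sup>2) * (C * indicator B w))"
    using ind shift_sq by (intro mu2.integrable_mult_pair Bochner_Integration.integrable_add integrable_mult_right) auto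
  show "(\<lambda>p. indicator K p *\<^sub>R g (t - fst p) *\<^sub>R twist t (snd p) (stft g f p)) \<in> borel_measurable (mu \<Otimes>\<^sub>M mu)"
    using borel_measurable_stft[OF fm] by measurable
  have le: "\<bar>a\<bar> \<le> 1 + a\<^sup>2" for a :: real
    using sum_squares_bound[of "\<bar>a\<bar>" 1] zero_le_power2[of a] unfolding power2_abs by simp
  show "AE p in mu \<Otimes>\<^sub>M mu. norm (indicator K p *\<^sub>R g (t - fst p) *\<^sub>R twist t (snd p) (stft g f p))
      \<le> norm (case p of (x, w) \<Rightarrow> (indicator A x + (g (t - x))\<^sup>2) * (C * indicator B w))"
  proof (rule AE_I2)
    fix p :: "('a \<times> 'b) \<times> 'a \<times> 'b"
    show "norm (indicator K p *\<^sub>R g (t - fst p) *\<^sub>R twist t (snd p) (stft g f p))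
      \<le> norm (case p of (x, w) \<Rightarrow> (indicator A x + (g (t - x))\<^sup>2) * (C * indicator B w))"
    proof (cases "p \<in> K")
      case True
      then have "fst p \<in> A" "snd p \<in> B" by (auto simp: A_def B_def)
      moreover have "\<bar>g (t - fst p)\<bar> * norm (stft g f p) \<le> (1 + (g (t - fst p))\<^sup>2) * C"
        by (intro mult_mono C le) auto
      ultimately show ?thesis
        using True \<open>0 \<le> C\<close> by (simp add: case_prod_beta abs_mult)
    qed simp
  qed
qed

text \<open>Fubini brings the integral over \<open>t\<close> inside, and moving the kernel onto
  \<open>q\<close> by \<open>inner_twist\<close> forms \<open>stft g q\<close>.\<close>

lemma integral_inner_synthesis:
  fixes f q :: "'a \<times> 'b \<Rightarrow> quat"
  assumes f: "square_integrable f" and q: "square_integrable q" and K: "compact K"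
  defines "S \<equiv> \<lambda>t. (LINT p:K|(mu \<Otimes>\<^sub>M mu). g (t - fst p) *\<^sub>R twist t (snd p) (stft g f p))"
  shows "(LINT t|mu. S t \<bullet> q t) = (LINT p:K|(mu \<Otimes>\<^sub>M mu). stft g f p \<bullet> stft g q p)"
proof -
  note fm[measurable] = square_integrableD(1)[OF f] 
  note qm[measurable] = square_integrableD(1)[OF q]
  note [measurable] = borel_measurable_stft[OF fm]
  have Km[measurable]: "K \<in> sets (mu \<Otimes>\<^sub>M mu)"
    unfolding sets_mu_pair using K by (rule borel_compact)
  have Ki: "integrable (mu \<Otimes>\<^sub>M mu) (indicator K :: ('a \<times> 'b) \<times> ('a \<times> 'b) \<Rightarrow> real)"
    using emeasure_mu_pair_compact_finite[OF K] by (intro integrable_real_indicator Km) auto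
  define C where "C = (LINT y|mu. (g y)\<^sup>2) + (LINT y|mu. (norm (f y))\<^sup>2)"
  have C: "norm (stft g f p) \<le> C" for p
    unfolding C_def by (rule norm_stft_le[OF f])
  have "0 \<le> C" using C[of 0] norm_ge_zero order_trans by blast
  let ?F = "\<lambda>t p. indicator K p *\<^sub>R (g (t - fst p) * (stft g f p \<bullet> twist (- t) (snd p) (q t)))"
  have "S t \<bullet> q t = (LINT p|(mu \<Otimes>\<^sub>M mu). ?F t p)" for t
    unfolding S_def set_lebesgue_integral_def
    using set_integrable_synthesis[OF f K, of t]
    by (subst integral_inner_left[symmetric]) (auto simp: set_integrable_def inner_twist mult.assoc)
  then have "(LINT t|mu. S t \<bullet> q t) = (LINT t|mu. LINT p|(mu \<Otimes>\<^sub>M mu). ?F t p)"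
    by presburger
  also have "\<dots> = (LINT p|(mu \<Otimes>\<^sub>M mu). LINT t|mu. ?F t p)"
  proof (rule mu3.Fubini_integral[symmetric], rule Bochner_Integration.integrable_bound)
    \<comment> \<open>On \<open>K\<close> the integrand is at most C (|q(t)|^2 + g(t - x)^2). The
      first term is a product function; the second is integrated over \<open>t\<close> first, where
      the shift by \<open>x\<close> disappears, hence the swapped product.\<close>
    have 1: "integrable (mu \<Otimes>\<^sub>M (mu \<Otimes>\<^sub>M mu)) (\<lambda>(t, p). (norm (q t))\<^sup>2 * (C * indicator K p))"
      using Ki square_integrableD(2)[OF q] by (intro mu3.integrable_mult_pair integrable_mult_right)
    interpret sw: pair_sigma_finite "(mu :: ('a \<times> 'b) measure) \<Otimes>\<^sub>M (mu :: ('a \<times> 'b) measure)" "mu :: ('a \<times> 'b) measure"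
      by (intro pair_sigma_finite.intro mu.sigma_finite_measure_axioms mu2.P.sigma_finite_measure_axioms)
    have "integrable ((mu \<Otimes>\<^sub>M mu) \<Otimes>\<^sub>M mu) (\<lambda>(p, t). C * indicator K p * (g (t - fst p))\<^sup>2)"
      by (rule sw.Fubini_integrable) (use Ki shift_sq in \<open>auto simp: abs_mult\<close>)
    from sw.integrable_product_swap[OF this]
    have 2: "integrable (mu \<Otimes>\<^sub>M (mu \<Otimes>\<^sub>M mu)) (\<lambda>(t, p). C * indicator K p * (g (t - fst p))\<^sup>2)"
      by (simp add: case_prod_beta)
    show "integrable (mu \<Otimes>\<^sub>M (mu \<Otimes>\<^sub>M mu)) (\<lambda>r. (case r of (t, p) \<Rightarrow> (norm (q t))\<^sup>2 * (C * indicator K p))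
       + (case r of (t, p) \<Rightarrow> C * indicator K p * (g (t - fst p))\<^sup>2))"
      by (rule Bochner_Integration.integrable_add[OF 1 2])
    have "\<bar>g (t - fst p) * (stft g f p \<bullet> twist (- t) (snd p) (q t))\<bar> \<le> (norm (q t))\<^sup>2 * C + C * (g (t - fst p))\<^sup>2" for t p
    proof -
      have "\<bar>g (t - fst p)\<bar> * \<bar>stft g f p \<bullet> twist (- t) (snd p) (q t)\<bar> \<le> \<bar>g (t - fst p)\<bar> * (C * norm (q t))"
        using Cauchy_Schwarz_ineq2[of "stft g f p" "twist (- t) (snd p) (q t)"] mult_right_mono[OF C, of "norm (q t)" p]
        by (intro mult_left_mono) auto
      also have "\<dots> = C * (\<bar>g (t - fst p)\<bar> * norm (q t))"
        by (simp add: mult_ac)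
      also have "\<dots> \<le> C * ((g (t - fst p))\<^sup>2 + (norm (q t))\<^sup>2)"
        using abs_mult_le_sum_squares[of "g (t - fst p)" "norm (q t)"] \<open>0 \<le> C\<close>
        by (intro mult_left_mono) auto
      finally show ?thesis
        by (simp add: abs_mult algebra_simps)
    qed
    then show "AE r in mu \<Otimes>\<^sub>M (mu \<Otimes>\<^sub>M mu). norm (case r of (t, p) \<Rightarrow> ?F t p)
      \<le> norm ((case r of (t, p) \<Rightarrow> (norm (q t))\<^sup>2 * (C * indicator K p)) + (case r of (t, p) \<Rightarrow> C * indicator K p * (g (t - fst p))\<^sup>2))"
      using \<open>0 \<le> C\<close> by (auto intro!: AE_I2 order_trans[OF _ abs_ge_self] simp: case_prod_beta split: split_indicator)
  qed measurable
  also have "\<dots> = (LINT p:K|(mu \<Otimes>\<^sub>M mu). stft g f p \<bullet> stft g q p)"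
    unfolding set_lebesgue_integral_def
  proof (rule Bochner_Integration.integral_cong[OF refl])
    fix p :: "('a \<times> 'b) \<times> 'a \<times> 'b"
    have "(LINT t|mu. g (t - fst p) * (stft g f p \<bullet> twist (- t) (snd p) (q t)))
      = (LINT t|mu. stft g f p \<bullet> twist (- t) (snd p) (g (t - fst p) *\<^sub>R q t))"
      by (simp add: twist_scaleR)
    also have "\<dots> = stft g f p \<bullet> stft g q p"
      unfolding stft_def[of g q] qft_def
      by (intro integral_inner_right integrable_twist integrable_windowed q) auto
    finally show "(LINT t|mu. ?F t p) = indicator K p *\<^sub>R (stft g f p \<bullet> stft g q p)"
      by simp
  qed
  finally show ?thesis .
qed

end

section \<open>Synthesis and reconstruction\<close>

text \<open>Monotone convergence. It allows a function to be tested against its own truncations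
  before it is known to be in L2.\<close>

lemma square_integrable_of_truncations:
  fixes r :: "'a::euclidean_space \<Rightarrow> 'b::euclidean_space"
  assumes "r \<in> borel_measurable borel"
    and le: "\<And>n. (LINT y|mu. (norm (truncate_to_ball (real n) r y))\<^sup>2) \<le> B"
  shows "square_integrable r"
proof (rule square_integrableI)
  note [measurable] = assms(1)
  let ?q = "\<lambda>n y. (norm (truncate_to_ball (real n) r y))\<^sup>2"
  have i: "integrable mu (?q n)" for n
    by (intro square_integrableD square_integrable_truncate_to_ball assms) auto
  have mono: "?q m y \<le> ?q n y" if "m \<le> n" for m n y
    using that by (auto simp: truncate_to_ball_def)
  have "incseq (\<lambda>n. integral\<^sup>L mu (?q n))"
    by (intro monoI integral_mono i mono)
  then obtain L where L: "(\<lambda>n. integral\<^sup>L mu (?q n)) \<longlonglongrightarrow> L"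
    using incseq_convergent[of "\<lambda>n. integral\<^sup>L mu (?q n)" B] le by blast
  show "integrable mu (\<lambda>x. (norm (r x))\<^sup>2)"
  proof (rule integrable_monotone_convergence[OF i _ _ L])
    show "AE y in mu. mono (\<lambda>n. ?q n y)"
      by (intro AE_I2 monoI mono)
    show "AE y in mu. (\<lambda>n. ?q n y) \<longlonglongrightarrow> (norm (r y))\<^sup>2"
      by (intro AE_I2 tendsto_power tendsto_norm truncate_to_ball_tendsto)
  qed measurable
qed fact

text \<open>Expand the square of \<open>c *\<^sub>R a + b\<close>. In its uses \<open>c\<close> is
  the squared norm of \<open>g\<close>: as \<open>stft g\<close> multiplies squared norms by that
  number, the second term integrates to half the squared norm of the test function, which is
  absorbed on the left.\<close>

lemma neg_inner_le_weighted:
  fixes a b :: "'a::real_inner"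
  assumes "0 < (c::real)"
  shows "- (a \<bullet> b) \<le> c / 2 * (norm a)\<^sup>2 + (norm b)\<^sup>2 / (2 * c)"
proof -
  have "0 \<le> (norm (c *\<^sub>R a + b))\<^sup>2 / (2 * c)"
    using assms by simp
  also have "\<dots> = c / 2 * (norm a)\<^sup>2 + (norm b)\<^sup>2 / (2 * c) + a \<bullet> b"
    using assms by (simp add: power2_norm_eq_inner inner_add inner_commute field_simps)
  finally show ?thesis by simp
qed

lemma window_norm_pos:
  fixes g :: "'a::euclidean_space \<Rightarrow> real"
  assumes "window g"
  shows "0 < (LINT y|mu. (g y)\<^sup>2)"
proof -
  have i: "integrable mu (\<lambda>y. (g y)\<^sup>2)"
    using assms square_integrableD(2)[of g] by (simp add: window_def)
  have "(LINT y|mu. (g y)\<^sup>2) \<noteq> 0"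
    using assms integral_nonneg_eq_0_iff_AE[OF i] by (auto simp: window_def)
  moreover have "0 \<le> (LINT y|mu. (g y)\<^sup>2)"
    by (rule integral_nonneg_AE) auto
  ultimately show ?thesis by linarith
qed

context
  fixes g :: "'a::euclidean_space \<times> 'b::euclidean_space \<Rightarrow> real" and f :: "'a \<times> 'b \<Rightarrow> quat"
  assumes w: "window g" and f: "square_integrable f"
begin

private lemma g: "square_integrable g"
  using w by (simp add: window_def)

private abbreviation (input) "N \<equiv> (norm2 g)\<^sup>2"

private lemma N_def: "N = (LINT y|mu. (g y)\<^sup>2)"
  by (simp add: norm2_def integral_nonneg_AE)

private lemma N: "0 < N"
  unfolding N_def by (rule window_norm_pos[OF w])

private lemma stft_integrable:
  assumes "square_integrable q"
  shows "integrable (mu \<Otimes>\<^sub>M mu) (\<lambda>p. (norm (stft g q p))\<^sup>2)"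
    "(LINT p|(mu \<Otimes>\<^sub>M mu). (norm (stft g q p))\<^sup>2) = N * (LINT y|mu. (norm (q y))\<^sup>2)"
  using has_bochner_integral_norm_stft[OF g assms] by (simp_all add: has_bochner_integral_iff N_def)

private lemma inner_stft_integrable:
  assumes q: "square_integrable q"
  shows "integrable (mu \<Otimes>\<^sub>M mu) (\<lambda>p. stft g f p \<bullet> stft g q p)"
proof (rule Bochner_Integration.integrable_bound)
  show "integrable (mu \<Otimes>\<^sub>M mu) (\<lambda>p. (norm (stft g f p))\<^sup>2 + (norm (stft g q p))\<^sup>2)"
    using stft_integrable f q by simp
  show "AE p in mu \<Otimes>\<^sub>M mu. norm (stft g f p \<bullet> stft g q p) \<le> norm ((norm (stft g f p))\<^sup>2 + (norm (stft g q p))\<^sup>2)"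
    by (auto intro: abs_inner_le_norm_squares)
  show "(\<lambda>p. stft g f p \<bullet> stft g q p) \<in> borel_measurable (mu \<Otimes>\<^sub>M mu)"
    using borel_measurable_stft[OF g] square_integrableD(1)[OF f] square_integrableD(1)[OF q] by measurable
qed

text \<open>Left without the factor 1 / N, so that adjointness carries no constant; the limit is
  then N f.\<close>

definition synthesis :: "(('a \<times> 'b) \<times> ('a \<times> 'b)) set \<Rightarrow> 'a \<times> 'b \<Rightarrow> quat" where
  "synthesis K t = (LINT p:K|(mu \<Otimes>\<^sub>M mu). g (t - fst p) *\<^sub>R twist t (snd p) (stft g f p))"

lemma borel_measurable_synthesis:
  assumes K: "compact K"
  shows "synthesis K \<in> borel_measurable borel"
proof -
  note [measurable] = borel_measurable_stft[OF g square_integrableD(1)[OF f]] square_integrableD(1)[OF g]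
  have [measurable]: "K \<in> sets (mu \<Otimes>\<^sub>M mu)"
    unfolding sets_mu_pair using K by (rule borel_compact)
  have "(\<lambda>t. LINT p|(mu \<Otimes>\<^sub>M mu). indicator K p *\<^sub>R g (t - fst p) *\<^sub>R twist t (snd p) (stft g f p)) \<in> borel_measurable borel"
    by (rule mu2.P.borel_measurable_lebesgue_integral) measurable
  then show ?thesis
    unfolding synthesis_def[abs_def] set_lebesgue_integral_def .
qed

text \<open>The synthesis operator is the adjoint of \<open>stft g\<close>, which is \<open>sqrt N\<close> times an isometry;
  testing against truncations of \<open>synthesis K\<close> itself bounds its norm.\<close>
lemma square_integrable_synthesis:
  assumes K: "compact K"
  shows "square_integrable (synthesis K)"
proof (rule square_integrable_of_truncations[OF borel_measurable_synthesis[OF K]])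
  fix n
  have Km: "K \<in> sets (mu \<Otimes>\<^sub>M mu)"
    unfolding sets_mu_pair using K by (rule borel_compact)
  define q where "q = truncate_to_ball (real n) (synthesis K)"
  have q: "square_integrable q"
    unfolding q_def by (intro square_integrable_truncate_to_ball borel_measurable_synthesis K) simp
  have "(LINT y|mu. (norm (q y))\<^sup>2) = (LINT t|mu. synthesis K t \<bullet> q t)"
    by (intro Bochner_Integration.integral_cong) (auto simp: q_def truncate_to_ball_def power2_norm_eq_inner)
  also have "\<dots> = (LINT p:K|(mu \<Otimes>\<^sub>M mu). stft g f p \<bullet> stft g q p)"
    unfolding synthesis_def by (rule integral_inner_synthesis[OF g f q K])
  also have "\<dots> \<le> (LINT p|(mu \<Otimes>\<^sub>M mu). N / 2 * (norm (stft g f p))\<^sup>2 + (norm (stft g q p))\<^sup>2 / (2 * N))"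
    unfolding set_lebesgue_integral_def
  proof (rule integral_mono)
    show "integrable (mu \<Otimes>\<^sub>M mu) (\<lambda>p. indicator K p *\<^sub>R (stft g f p \<bullet> stft g q p))"
      using inner_stft_integrable[OF q] Km by (rule integrable_mult_indicator[rotated])
    show "integrable (mu \<Otimes>\<^sub>M mu) (\<lambda>p. N / 2 * (norm (stft g f p))\<^sup>2 + (norm (stft g q p))\<^sup>2 / (2 * N))"
      using stft_integrable f q by simp
    \<comment> \<open>Reversing the sign of \<open>stft g f p\<close> turns the weighted inequality
      into an upper bound; off \<open>K\<close> the left side is 0.\<close>
    show "indicator K p *\<^sub>R (stft g f p \<bullet> stft g q p) \<le> N / 2 * (norm (stft g f p))\<^sup>2 + (norm (stft g q p))\<^sup>2 / (2 * N)" for p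
      using neg_inner_le_weighted[OF N, of "- stft g f p" "stft g q p"] N by (auto split: split_indicator)
  qed
  also have "\<dots> = N / 2 * (N * (LINT y|mu. (norm (f y))\<^sup>2)) + (LINT y|mu. (norm (q y))\<^sup>2) / 2"
    using stft_integrable[OF f] stft_integrable[OF q] N by simp
  finally show "(LINT y|mu. (norm (truncate_to_ball (real n) (synthesis K) y))\<^sup>2) \<le> N * (N * (LINT y|mu. (norm (f y))\<^sup>2))"
    unfolding q_def by simp
qed

text \<open>Pair the error \<open>r\<close> with itself. Adjointness gives an integral over
  \<open>K\<close>, and \<open>integral_inner_stft\<close> gives the same integrand over all of
  phase space for N f, so the difference lives off \<open>K\<close>. Half of the squared norm of
  \<open>r\<close> is then absorbed.\<close>

lemma norm_synthesis_error_le: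
  assumes K: "compact K"
  shows "(LINT t|mu. (norm (synthesis K t - N *\<^sub>R f t))\<^sup>2)
    \<le> N * (LINT p|(mu \<Otimes>\<^sub>M mu). indicator (- K) p * (norm (stft g f p))\<^sup>2)"
proof -
  have Km[measurable]: "K \<in> sets (mu \<Otimes>\<^sub>M mu)"
    unfolding sets_mu_pair using K by (rule borel_compact)
  have Cm: "- K \<in> sets (mu \<Otimes>\<^sub>M mu)"
    using Km by (metis Compl_eq_Diff_UNIV sets.compl_sets space_mu_pair)
  define r where "r t = synthesis K t - N *\<^sub>R f t" for t
  have r: "square_integrable r"
    unfolding r_def[abs_def] by (intro square_integrable_diff square_integrable_synthesis K square_integrable_scaleR f)
  note i = integrable_inner_square_integrable(1)[OF square_integrable_synthesis[OF K] r]
    integrable_inner_square_integrable(1)[OF f r]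
  have ic: "integrable (mu \<Otimes>\<^sub>M mu) (\<lambda>p. indicator (- K) p * (norm (stft g f p))\<^sup>2)"
    using integrable_mult_indicator[OF Cm stft_integrable(1)[OF f]] by simp
  have ik: "integrable (mu \<Otimes>\<^sub>M mu) (\<lambda>p. indicator K p * (stft g f p \<bullet> stft g r p))"
    using integrable_mult_indicator[OF Km inner_stft_integrable[OF r]] by simp
  have "(LINT t|mu. (norm (r t))\<^sup>2) = (LINT t|mu. synthesis K t \<bullet> r t - N * (f t \<bullet> r t))"
    by (intro Bochner_Integration.integral_cong) (auto simp: r_def power2_norm_eq_inner inner_diff_left)
  also have "\<dots> = (LINT t|mu. synthesis K t \<bullet> r t) - N * (LINT t|mu. f t \<bullet> r t)"
    using i by simp
  also have "\<dots> = (LINT p:K|(mu \<Otimes>\<^sub>M mu). stft g f p \<bullet> stft g r p) - (LINT p|(mu \<Otimes>\<^sub>M mu). stft g f p \<bullet> stft g r p)"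
    unfolding integral_inner_stft[OF g f r] N_def synthesis_def
    by (simp add: integral_inner_synthesis[OF g f r K])
  also have "\<dots> = (LINT p|(mu \<Otimes>\<^sub>M mu). indicator K p * (stft g f p \<bullet> stft g r p) - stft g f p \<bullet> stft g r p)"
    unfolding set_lebesgue_integral_def using ik inner_stft_integrable[OF r] by simp
  also have "\<dots> \<le> (LINT p|(mu \<Otimes>\<^sub>M mu). N / 2 * (indicator (- K) p * (norm (stft g f p))\<^sup>2) + (norm (stft g r p))\<^sup>2 / (2 * N))"
  proof (rule integral_mono)
    show "indicator K p * (stft g f p \<bullet> stft g r p) - stft g f p \<bullet> stft g r p
        \<le> N / 2 * (indicator (- K) p * (norm (stft g f p))\<^sup>2) + (norm (stft g r p))\<^sup>2 / (2 * N)" for p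
      using neg_inner_le_weighted[OF N, of "stft g f p" "stft g r p"] N by (auto split: split_indicator)
  qed (use ic ik inner_stft_integrable[OF r] stft_integrable[OF r] in auto)
  also have "\<dots> = N / 2 * (LINT p|(mu \<Otimes>\<^sub>M mu). indicator (- K) p * (norm (stft g f p))\<^sup>2) + (LINT t|mu. (norm (r t))\<^sup>2) / 2"
    using ic stft_integrable[OF r] N by simp
  finally show ?thesis
    unfolding r_def by simp
qed

text \<open>The error bound is the tail of one integrable function, and every point lies in
  \<open>K n\<close> from some index on.\<close>

lemma synthesis_L2_tendsto:
  assumes K: "\<And>n. compact (K n)" "incseq K" "(\<Union>n. K n) = UNIV"
  shows "(\<lambda>n. norm2 (\<lambda>t. synthesis (K n) t - N *\<^sub>R f t)) \<longlonglongrightarrow> 0"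
proof -
  note [measurable] = borel_measurable_stft[OF g square_integrableD(1)[OF f]]
  have Cm[measurable]: "- K n \<in> sets (mu \<Otimes>\<^sub>M mu)" for n
    unfolding sets_mu_pair using K(1)[of n] by (auto intro!: borel_open simp: compact_imp_closed open_Compl)
  have "(\<lambda>n. LINT p|(mu \<Otimes>\<^sub>M mu). indicator (- K n) p * (norm (stft g f p))\<^sup>2) \<longlonglongrightarrow> (LINT p::('a\<times>'b)\<times>('a\<times>'b)|(mu \<Otimes>\<^sub>M mu). 0)"
  proof (rule integral_dominated_convergence[where w="\<lambda>p. (norm (stft g f p))\<^sup>2"])
    show "AE p in mu \<Otimes>\<^sub>M mu. (\<lambda>n. indicator (- K n) p * (norm (stft g f p))\<^sup>2) \<longlonglongrightarrow> 0"
    proof (rule AE_I2)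
      fix p
      obtain m where "p \<in> K m" using K(3) by blast
      then have "p \<in> K n" if "m \<le> n" for n
        using K(2) that by (auto simp: incseq_def)
      then show "(\<lambda>n. indicator (- K n) p * (norm (stft g f p))\<^sup>2) \<longlonglongrightarrow> 0"
        by (intro tendsto_eventually eventually_sequentiallyI[of m]) auto
    qed
    show "AE p in mu \<Otimes>\<^sub>M mu. norm (indicator (- K n) p * (norm (stft g f p))\<^sup>2) \<le> (norm (stft g f p))\<^sup>2" for n
      by (intro AE_I2) (auto split: split_indicator)
  qed (use stft_integrable(1)[OF f] in measurable)
  then have "(\<lambda>n. N * (LINT p|(mu \<Otimes>\<^sub>M mu). indicator (- K n) p * (norm (stft g f p))\<^sup>2)) \<longlonglongrightarrow> 0"
    by (auto intro!: tendsto_eq_intros)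
  then have "(\<lambda>n. LINT t|mu. (norm (synthesis (K n) t - N *\<^sub>R f t))\<^sup>2) \<longlonglongrightarrow> 0"
    by (rule tendsto_sandwich[OF _ _ tendsto_const, rotated 2])
       (auto intro!: always_eventually norm_synthesis_error_le K integral_nonneg_AE)
  then show ?thesis
    unfolding norm2_def using tendsto_real_sqrt by fastforce
qed

text \<open>Inversion on slices gives a null set of \<open>t\<close> for almost every
  \<open>x\<close>, whereas reconstruction fixes \<open>t\<close> and integrates over
  \<open>x\<close>. Exchanging the quantifiers requires a jointly measurable exceptional
  set.\<close>

lemma AE_stft_inversion:
  "AE t in mu. AE x in mu. integrable mu (\<lambda>w. stft g f (x, w)) \<longrightarrow>
     (LINT w|mu. twist t w (stft g f (x, w))) = g (t - x) *\<^sub>R f t"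
proof -
  note [measurable] = borel_measurable_stft[OF g square_integrableD(1)[OF f]]
    square_integrableD(1)[OF f] square_integrableD(1)[OF g]
  let ?P = "\<lambda>x t. integrable mu (\<lambda>w. stft g f (x, w)) \<longrightarrow>
     (LINT w|mu. twist t w (stft g f (x, w))) = g (t - x) *\<^sub>R f t"
  have "AE x in mu. AE t in mu. ?P x t"
    using AE_square_integrable_windowed[OF g f]
  proof eventually_elim
    case (elim x)
    show ?case
    proof (cases "integrable mu (\<lambda>w. stft g f (x, w))")
      case True
      then show ?thesis
        using qft_inversion[OF integrable_windowed[OF g f] elim] by (simp add: stft_def)
    qed simp
  qed
  moreover have "{z \<in> space (mu \<Otimes>\<^sub>M mu). ?P (fst z) (snd z)} \<in> sets (mu \<Otimes>\<^sub>M mu)"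
  proof -
    have "(\<lambda>w. stft g f (x, w)) \<in> borel_measurable mu" for x
      by measurable
    \<comment> \<open>Integrability in \<open>w\<close> becomes a measurable condition on
      \<open>x\<close> once written as finiteness of a non-negative integral.\<close>
    then have eq: "integrable mu (\<lambda>w. stft g f (x, w)) \<longleftrightarrow> (\<integral>\<^sup>+ w. norm (stft g f (x, w)) \<partial>mu) < \<infinity>" for x
      by (simp add: integrable_iff_bounded)
    have [measurable]: "(\<lambda>z. \<integral>\<^sup>+ w. norm (stft g f (fst z, w)) \<partial>mu) \<in> borel_measurable (mu \<Otimes>\<^sub>M mu)"
      by (rule mu.borel_measurable_nn_integral) measurable
    have [measurable]: "(\<lambda>z. LINT w|mu. twist (snd z) w (stft g f (fst z, w))) \<in> borel_measurable (mu \<Otimes>\<^sub>M mu)"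
      by (rule mu.borel_measurable_lebesgue_integral) measurable
    show ?thesis
      unfolding eq by measurable
  qed
  ultimately show ?thesis
    using mu2.AE_commute[of ?P] by simp
qed

text \<open>The inner integral equals \<open>(g (t - x))\<^sup>2 *\<^sub>R f t\<close> for almost
  every \<open>x\<close>, and reflection invariance turns the outer one into the squared norm of the
  window.\<close>

lemma AE_iterated_inversion:
  "AE t in mu. (AE x in mu. integrable mu (\<lambda>w. g (t - x) *\<^sub>R twist t w (stft g f (x, w)))) \<longrightarrow>
     has_bochner_integral mu (\<lambda>x. LINT w|mu. g (t - x) *\<^sub>R twist t w (stft g f (x, w))) (N *\<^sub>R f t)"
  using AE_stft_inversion
proof eventually_elim
  case (elim t)
  note [measurable] = borel_measurable_stft[OF g square_integrableD(1)[OF f]] square_integrableD(1)[OF g]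
  show ?case
  proof
    assume "AE x in mu. integrable mu (\<lambda>w. g (t - x) *\<^sub>R twist t w (stft g f (x, w)))"
    with elim have eq: "AE x in mu. (g (t - x))\<^sup>2 *\<^sub>R f t = (LINT w|mu. g (t - x) *\<^sub>R twist t w (stft g f (x, w)))"
    proof eventually_elim
      case (elim x)
      show ?case
      \<comment> \<open>Where the window vanishes the premise says nothing about
        \<open>stft g f\<close>, but both sides are 0; elsewhere the scalar can be divided
        out.\<close>
      proof (cases "g (t - x) = 0")
        case False
        with elim(2) have "integrable mu (\<lambda>w. twist t w (stft g f (x, w)))"
          by (simp add: integrable_scaleR_iff)
        then have "integrable mu (\<lambda>w. stft g f (x, w))"
          by (rule Bochner_Integration.integrable_bound) auto
        with elim(1) show ?thesis
          by (simp add: power2_eq_square)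
      qed simp
    qed
    have i: "integrable mu (\<lambda>x. (g (t - x))\<^sup>2)" "(LINT x|mu. (g (t - x))\<^sup>2) = N"
      using square_integrableD(2)[OF g] integrable_mu_reflect[of "\<lambda>y. (g y)\<^sup>2" t]
        integral_mu_reflect[of "\<lambda>y. (g y)\<^sup>2" t] by (simp_all add: N_def)
    then have "has_bochner_integral mu (\<lambda>x. (g (t - x))\<^sup>2 *\<^sub>R f t) (N *\<^sub>R f t)"
      by (intro has_bochner_integral_scaleR_left) (simp add: has_bochner_integral_iff)
    then show "has_bochner_integral mu (\<lambda>x. LINT w|mu. g (t - x) *\<^sub>R twist t w (stft g f (x, w))) (N *\<^sub>R f t)"
      by (rule has_bochner_integral_cong_AE[THEN iffD1, rotated 3]) (use eq in \<open>auto simp: eq_commute\<close>)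
  qed
qed

end

section \<open>Return to the notions of the statement\<close>

lemma qwft_eq_stft: "qwft (\<lambda>y. of_real (g y)) f x w = stft g f (x, w)"
proof -
  have "exp (- (a *\<^sub>R qi)) * q * qcnj (of_real c) * exp (- (b *\<^sub>R qj))
      = exp ((- a) *\<^sub>R qi) * (c *\<^sub>R q) * exp ((- b) *\<^sub>R qj)" for a b c :: real and q :: quat
  proof -
    have "qcnj (of_real c) = of_real c"
      by (simp add: of_real_def qcnj_def one_quat_def quat_eq_iff)
    then show ?thesis
      by (simp add: of_real_def)
  qed
  then show ?thesis
    unfolding qwft_def stft_def qft_def twist_def by simp
qed

lemma qwft_synthesis_integrand_eq:
  "qwft_synthesis_integrand g f t x w = g (t - x) *\<^sub>R twist t w (stft g f (x, w))"
  unfolding qwft_synthesis_integrand_def qwft_eq_stft by (simp add: twist_def of_real_def)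

text \<open>\<open>has_L2_integral\<close> determines \<open>h\<close> only up to a null set, hence
  the existential and the equality almost everywhere. The second conjunct reads the double integral
  as an iterated Lebesgue integral; its premise keeps out inner integrals that would default to 0,
  and integrability of the outer one is concluded for the same reason.\<close>

theorem theorem5:
  fixes f :: "(real^'d) \<times> (real^'d) \<Rightarrow> quat" and g :: "(real^'d) \<times> (real^'d) \<Rightarrow> real"
  assumes "window g" and "square_integrable f"
  shows "(\<exists>h. has_L2_integral (mu \<Otimes>\<^sub>M mu) (\<lambda>t (x, w). qwft_synthesis_integrand g f t x w) h \<and>
             (AE t in mu. f t = (1 / (norm2 g)\<^sup>2) *\<^sub>R h t))
       \<and> (AE t in mu. (AE x in mu. integrable mu (\<lambda>w. qwft_synthesis_integrand g f t x w)) \<longrightarrow>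
             integrable mu (\<lambda>x. LINT w|mu. qwft_synthesis_integrand g f t x w) \<and>
             f t = (1 / (norm2 g)\<^sup>2) *\<^sub>R (LINT x|mu. LINT w|mu. qwft_synthesis_integrand g f t x w))"
proof (intro conjI exI)
  have g: "square_integrable g"
    using assms(1) by (simp add: window_def)
  have N: "(norm2 g)\<^sup>2 \<noteq> 0"
    using window_norm_pos[OF assms(1)] by (simp add: norm2_def)
  have F: "(\<lambda>(x, w). qwft_synthesis_integrand g f t x w) = (\<lambda>p. g (t - fst p) *\<^sub>R twist t (snd p) (stft g f p))" for t
    by (auto simp: qwft_synthesis_integrand_eq)
  show "has_L2_integral (mu \<Otimes>\<^sub>M mu) (\<lambda>t (x, w). qwft_synthesis_integrand g f t x w) (\<lambda>t. (norm2 g)\<^sup>2 *\<^sub>R f t)"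
    unfolding has_L2_integral_def F
    using set_integrable_synthesis[OF g assms(2)] square_integrable_synthesis[OF assms] synthesis_L2_tendsto[OF assms]
    unfolding synthesis_def[OF assms]
    by (auto intro!: square_integrable_scaleR assms(2))
  show "AE t in mu. f t = (1 / (norm2 g)\<^sup>2) *\<^sub>R (norm2 g)\<^sup>2 *\<^sub>R f t"
    using N by simp
  show "AE t in mu. (AE x in mu. integrable mu (\<lambda>w. qwft_synthesis_integrand g f t x w)) \<longrightarrow>
             integrable mu (\<lambda>x. LINT w|mu. qwft_synthesis_integrand g f t x w) \<and>
             f t = (1 / (norm2 g)\<^sup>2) *\<^sub>R (LINT x|mu. LINT w|mu. qwft_synthesis_integrand g f t x w)"
    using AE_iterated_inversion[OF assms]
    by eventually_elim (use N in \<open>auto simp: qwft_synthesis_integrand_eq has_bochner_integral_iff\<close>)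
qed

end
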